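(* Let $\mathfrak{F}$ be a fractal curve with rise function $J$ as described in the context, let $n\ge1$ be an integer, and let $f\in C^{n}(\mathfrak{F})$ have fractal Mellin transform $M$. Then the fractal Mellin transform of the $n$-th $F^{\alpha}$-derivative of $f$ is $$\mathcal{M}\big[(D_{\mathfrak{F}}^{\alpha})^{n}f(\theta)\big]=\frac{\Gamma(1-J(s)+n)}{\Gamma(1-J(s))}\,M(J(s)-n),$$ for every value $J(s)\in\mathbb{C}$ of the transform variable such that the Mellin transform of $(D_{\mathfrak{F}}^{\alpha})^{n}f$ exists at $J(s)$ and the Mellin transform of $f$ exists at $J(s)-n$.
   Context: Fractal curve. $\mathfrak{F}\subset\mathbb{R}^{d}$ is a curve with a continuous bijective parametrization $\mathbf{v}:[0,\infty)\to\mathfrak{F}$, and $1\le\alpha\le d$. For $c_1<c_2$ the mass function is $$\zeta^{\alpha}(\mathfrak{F},c_1,c_2)=\lim_{\delta\to0}\ \inf_{|P|\le\delta}\ \sum_{i=0}^{N-1}\frac{|\mathbf{v}(z_{i+1})-\mathbf{v}(z_i)|^{\alpha}}{\Gamma(\alpha+1)},$$ the infimum being over subdivisions $P=\{c_1=z_0<\dots<z_N=c_2\}$ with mesh $|P|=\max_i(z_{i+1}-z_i)\le\delta$, and $|\cdot|$ on vectors the Euclidean norm. The rise function is $S_{\mathfrak{F}}^{\alpha}(z)=\zeta^{\alpha}(\mathfrak{F},0,z)$, and for $\theta=\mathbf{v}(z)$ one writes $J(\theta)=S_{\mathfrak{F}}^{\alpha}(z)$. It is assumed that $S_{\mathfrak{F}}^{\alpha}$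 is finite, continuous, strictly increasing and maps $[0,\infty)$ onto $[0,\infty)$. The point of $\mathfrak{F}$ with $J=0$ is written $0$. $F^{\alpha}$-derivative. $$D_{\mathfrak{F}}^{\alpha}f(\theta)=\lim_{\theta'\to\theta,\ \theta'\in\mathfrak{F}}\frac{f(\theta')-f(\theta)}{J(\theta')-J(\theta)},$$ the limit being taken along $\mathfrak{F}$ (the fractal limit); $(D_{\mathfrak{F}}^{\alpha})^{n}$ is its $n$-fold iterate. $C^{n}(\mathfrak{F})$ is the set of functions on $\mathfrak{F}$ (away from the endpoint $0$) that are $n$ times $F^{\alpha}$-differentiable with continuous $n$-th derivative. $\mathfrak{F}^{\alpha}$-integral. $D(c_1,c_2)$ denotes the section of $\mathfrak{F}$ between $\mathbf{v}(c_1)$ and $\mathbf{v}(c_2)$; $C(z_i,z_{i+1})$ denotes the part of $\mathfrak{F}$ between $\mathbf{v}(z_i)$ and $\mathbf{v}(z_{i+1})$. For a bounded real function $f$, $$\int_{D(c_1,c_2)}f(\theta)\,d_{\mathfrak{F}}^{\alpha}\theta=\sup_{P}\sum_{i}\inf_{\theta\in C(z_i,z_{i+1})}f(\theta)\,(J(\theta_{i+1})-J(\theta_i))=\inf_{P}\sum_{i}\sup_{\theta\in C(z_i,z_{i+1})}f(\theta)\,(J(\theta_{i+1})-J(\theta_i)),$$ where $\theta_i=\mathbf{v}(z_i)$, $P$ ranges over all subdivisions of $[c_1,c_2]$, and the two expressions are required to agree. Complex functions are integrated through real and imaginary parts, and integrals over $D(0,\infty)$ or of functions unbounded at an endpoint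 are improper integrals. $D(0,1)$ and $D(1,\infty)$ in the Mellin conditions denote the parts of $\mathfrak{F}$ where $0\le J\le1$ and $J\ge1$. Fractal Mellin transform. $$M(J(s))=\mathcal{M}[f(\theta)]=\int_{D(0,\infty)}f(\theta)\,J(\theta)^{J(s)-1}\,d_{\mathfrak{F}}^{\alpha}\theta,$$ where $J(s)$ denotes the complex transform variable. The transform of $f$ is said to exist at $J(s)$ if $f$ is piecewise continuous on every closed section $D(a,b)\subset D(0,\infty)$ and there are reals $\lambda_1<\mathrm{Re}\,J(s)<\lambda_2$ with $\int_{D(0,1)}|f(\theta)|J(\theta)^{\lambda_1-1}d_{\mathfrak{F}}^{\alpha}\theta<\infty$ and $\int_{D(1,\infty)}|f(\theta)|J(\theta)^{\lambda_2-1}d_{\mathfrak{F}}^{\alpha}\theta<\infty$. $\Gamma(1-J(s)+n)/\Gamma(1-J(s))$ is understood as the product $\prod_{j=1}^{n}(j-J(s))$ at points where the Gamma functions have poles. *)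

theory Defs
  imports "HOL-Analysis.Analysis"
begin

text \<open>
  A curve is given by its parametrization \<open>v\<close> on \<open>{0..}\<close>. Functions on the curve are total
  functions on the ambient space; their values off the curve are never used.
\<close>

definition curve :: "(real \<Rightarrow> real ^ 'd) \<Rightarrow> (real ^ 'd) set" where
  "curve v = v ` {0..}"

text \<open>Subdivisions \<open>c1 = z 0 < \<dots> < z N = c2\<close>; only \<open>z 0, \<dots>, z N\<close> matter.
  For \<open>c1 = c2\<close> only \<open>N = 0\<close> is possible, so that the mass of a point is \<open>0\<close>.\<close>

definition subdivisions :: "real \<Rightarrow> real \<Rightarrow> (nat \<times> (nat \<Rightarrow> real)) set" where
  "subdivisions c1 c2 = {(N, z). z 0 = c1 \<and> z N = c2 \<and> (\<forall>i<N. z i < z (Suc i))}"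

definition mass :: "(real \<Rightarrow> real ^ 'd) \<Rightarrow> real \<Rightarrow> real \<Rightarrow> real \<Rightarrow> ennreal" where
  "mass v \<alpha> c1 c2 =
     Lim (at_right 0) (\<lambda>\<delta>::real.
       INF (N, z) \<in> {(N, z) \<in> subdivisions c1 c2. \<forall>i<N. z (Suc i) - z i \<le> \<delta>}.
         ennreal (\<Sum>i<N. norm (v (z (Suc i)) - v (z i)) powr \<alpha> / Gamma (\<alpha> + 1)))"

definition rise :: "(real \<Rightarrow> real ^ 'd) \<Rightarrow> real \<Rightarrow> real \<Rightarrow> real" where
  "rise v \<alpha> z = enn2real (mass v \<alpha> 0 z)"

definition J :: "(real \<Rightarrow> real ^ 'd) \<Rightarrow> real \<Rightarrow> real ^ 'd \<Rightarrow> real" where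
  "J v \<alpha> \<theta> = rise v \<alpha> (inv_into {0..} v \<theta>)"

definition fractal_curve :: "(real \<Rightarrow> real ^ 'd) \<Rightarrow> real \<Rightarrow> bool" where
  "fractal_curve v \<alpha> \<longleftrightarrow>
     continuous_on {0..} v \<and> inj_on v {0..} \<and>
     1 \<le> \<alpha> \<and> \<alpha> \<le> real CARD('d) \<and>
     (\<forall>z\<ge>0. mass v \<alpha> 0 z < \<infinity>) \<and>
     continuous_on {0..} (rise v \<alpha>) \<and>
     strict_mono_on {0..} (rise v \<alpha>) \<and>
     rise v \<alpha> ` {0..} = {0..}"

text \<open>The limit is taken along the curve in the topology of the ambient space.\<close>

definition has_F_derivative ::
  "(real \<Rightarrow> real ^ 'd) \<Rightarrow> real \<Rightarrow> (real ^ 'd \<Rightarrow> complex) \<Rightarrow> complex \<Rightarrow> real ^ 'd \<Rightarrow> bool" where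
  "has_F_derivative v \<alpha> f D \<theta> \<longleftrightarrow>
     ((\<lambda>\<theta>'. (f \<theta>' - f \<theta>) / of_real (J v \<alpha> \<theta>' - J v \<alpha> \<theta>)) \<longlongrightarrow> D) (at \<theta> within curve v)"

definition F_deriv ::
  "(real \<Rightarrow> real ^ 'd) \<Rightarrow> real \<Rightarrow> (real ^ 'd \<Rightarrow> complex) \<Rightarrow> real ^ 'd \<Rightarrow> complex" where
  "F_deriv v \<alpha> f \<theta> = (THE D. has_F_derivative v \<alpha> f D \<theta>)"

definition C_n ::
  "(real \<Rightarrow> real ^ 'd) \<Rightarrow> real \<Rightarrow> nat \<Rightarrow> (real ^ 'd \<Rightarrow> complex) set" where
  "C_n v \<alpha> n =
     {f. (\<forall>k<n. \<forall>\<theta>\<in>curve v - {v 0}. \<exists>D. has_F_derivative v \<alpha> ((F_deriv v \<alpha> ^^ k) f) D \<theta>) \<and>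
         continuous_on (curve v - {v 0}) ((F_deriv v \<alpha> ^^ n) f)}"

definition lower_sum ::
  "(real \<Rightarrow> real ^ 'd) \<Rightarrow> real \<Rightarrow> (real ^ 'd \<Rightarrow> real) \<Rightarrow> nat \<times> (nat \<Rightarrow> real) \<Rightarrow> real" where
  "lower_sum v \<alpha> f = (\<lambda>(N, z). \<Sum>i<N.
     (INF \<theta>\<in>v ` {z i..z (Suc i)}. f \<theta>) * (J v \<alpha> (v (z (Suc i))) - J v \<alpha> (v (z i))))"

definition upper_sum ::
  "(real \<Rightarrow> real ^ 'd) \<Rightarrow> real \<Rightarrow> (real ^ 'd \<Rightarrow> real) \<Rightarrow> nat \<times> (nat \<Rightarrow> real) \<Rightarrow> real" where
  "upper_sum v \<alpha> f = (\<lambda>(N, z). \<Sum>i<N.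
     (SUP \<theta>\<in>v ` {z i..z (Suc i)}. f \<theta>) * (J v \<alpha> (v (z (Suc i))) - J v \<alpha> (v (z i))))"

definition F_integrable ::
  "(real \<Rightarrow> real ^ 'd) \<Rightarrow> real \<Rightarrow> (real ^ 'd \<Rightarrow> real) \<Rightarrow> real \<Rightarrow> real \<Rightarrow> bool" where
  "F_integrable v \<alpha> f c1 c2 \<longleftrightarrow>
     bounded (f ` v ` {c1..c2}) \<and>
     (SUP P\<in>subdivisions c1 c2. lower_sum v \<alpha> f P) = (INF P\<in>subdivisions c1 c2. upper_sum v \<alpha> f P)"

definition F_integral ::
  "(real \<Rightarrow> real ^ 'd) \<Rightarrow> real \<Rightarrow> (real ^ 'd \<Rightarrow> real) \<Rightarrow> real \<Rightarrow> real \<Rightarrow> real" where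
  "F_integral v \<alpha> f c1 c2 = (SUP P\<in>subdivisions c1 c2. lower_sum v \<alpha> f P)"

definition F_integrable_complex ::
  "(real \<Rightarrow> real ^ 'd) \<Rightarrow> real \<Rightarrow> (real ^ 'd \<Rightarrow> complex) \<Rightarrow> real \<Rightarrow> real \<Rightarrow> bool" where
  "F_integrable_complex v \<alpha> f c1 c2 \<longleftrightarrow>
     F_integrable v \<alpha> (\<lambda>\<theta>. Re (f \<theta>)) c1 c2 \<and> F_integrable v \<alpha> (\<lambda>\<theta>. Im (f \<theta>)) c1 c2"

definition F_integral_complex ::
  "(real \<Rightarrow> real ^ 'd) \<Rightarrow> real \<Rightarrow> (real ^ 'd \<Rightarrow> complex) \<Rightarrow> real \<Rightarrow> real \<Rightarrow> complex" where
  "F_integral_complex v \<alpha> f c1 c2 =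
     Complex (F_integral v \<alpha> (\<lambda>\<theta>. Re (f \<theta>)) c1 c2) (F_integral v \<alpha> (\<lambda>\<theta>. Im (f \<theta>)) c1 c2)"

text \<open>Improper integrals: over the whole curve with both ends approached independently, and
  convergence of the integral at the initial point and at infinity, respectively.
  Bounds are parameter values.\<close>

definition has_improper_F_integral ::
  "(real \<Rightarrow> real ^ 'd) \<Rightarrow> real \<Rightarrow> (real ^ 'd \<Rightarrow> complex) \<Rightarrow> complex \<Rightarrow> bool" where
  "has_improper_F_integral v \<alpha> f I \<longleftrightarrow>
     (\<forall>a b. 0 < a \<and> a < b \<longrightarrow> F_integrable_complex v \<alpha> f a b) \<and>
     ((\<lambda>(a, b). F_integral_complex v \<alpha> f a b) \<longlongrightarrow> I) (at_right 0 \<times>\<^sub>F at_top)"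

definition F_integral_finite_at_0 ::
  "(real \<Rightarrow> real ^ 'd) \<Rightarrow> real \<Rightarrow> (real ^ 'd \<Rightarrow> real) \<Rightarrow> real \<Rightarrow> bool" where
  "F_integral_finite_at_0 v \<alpha> f b \<longleftrightarrow>
     (\<forall>a. 0 < a \<and> a < b \<longrightarrow> F_integrable v \<alpha> f a b) \<and>
     (\<exists>I. ((\<lambda>a. F_integral v \<alpha> f a b) \<longlongrightarrow> I) (at_right 0))"

definition F_integral_finite_at_infinity ::
  "(real \<Rightarrow> real ^ 'd) \<Rightarrow> real \<Rightarrow> (real ^ 'd \<Rightarrow> real) \<Rightarrow> real \<Rightarrow> bool" where
  "F_integral_finite_at_infinity v \<alpha> f a \<longleftrightarrow>
     (\<forall>b>a. F_integrable v \<alpha> f a b) \<and>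
     (\<exists>I. ((\<lambda>b. F_integral v \<alpha> f a b) \<longlongrightarrow> I) at_top)"

text \<open>On each open piece \<open>f\<close> agrees with a function \<open>g\<close> continuous on the closed piece, i.e.
  \<open>f\<close> is continuous there with finite one-sided limits at the break points.\<close>

definition piecewise_continuous ::
  "(real \<Rightarrow> real ^ 'd) \<Rightarrow> (real ^ 'd \<Rightarrow> complex) \<Rightarrow> real \<Rightarrow> real \<Rightarrow> bool" where
  "piecewise_continuous v f a b \<longleftrightarrow>
     (\<exists>(N, z)\<in>subdivisions a b. \<forall>i<N. \<exists>g.
        continuous_on (v ` {z i..z (Suc i)}) g \<and> (\<forall>\<theta>\<in>v ` {z i<..<z (Suc i)}. f \<theta> = g \<theta>))"

text \<open>The parameter \<open>unit_param\<close> is the one at which \<open>J = 1\<close>.\<close>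

definition unit_param :: "(real \<Rightarrow> real ^ 'd) \<Rightarrow> real \<Rightarrow> real" where
  "unit_param v \<alpha> = inv_into {0..} (rise v \<alpha>) 1"

definition mellin_exists ::
  "(real \<Rightarrow> real ^ 'd) \<Rightarrow> real \<Rightarrow> (real ^ 'd \<Rightarrow> complex) \<Rightarrow> complex \<Rightarrow> bool" where
  "mellin_exists v \<alpha> f s \<longleftrightarrow>
     (\<forall>a b. 0 < a \<and> a < b \<longrightarrow> piecewise_continuous v f a b) \<and>
     (\<exists>l1 l2. l1 < Re s \<and> Re s < l2 \<and>
        F_integral_finite_at_0 v \<alpha> (\<lambda>\<theta>. norm (f \<theta>) * J v \<alpha> \<theta> powr (l1 - 1)) (unit_param v \<alpha>) \<and>
        F_integral_finite_at_infinity v \<alpha> (\<lambda>\<theta>. norm (f \<theta>) * J v \<alpha> \<theta> powr (l2 - 1)) (unit_param v \<alpha>))"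

text \<open>The variable \<open>s\<close> is the complex transform variable usually written \<open>J(s)\<close>.\<close>

definition mellin ::
  "(real \<Rightarrow> real ^ 'd) \<Rightarrow> real \<Rightarrow> (real ^ 'd \<Rightarrow> complex) \<Rightarrow> complex \<Rightarrow> complex" where
  "mellin v \<alpha> f s =
     (THE I. has_improper_F_integral v \<alpha> (\<lambda>\<theta>. f \<theta> * of_real (J v \<alpha> \<theta>) powr (s - 1)) I)"

text \<open>\<open>\<Gamma>(1 - s + n) / \<Gamma>(1 - s)\<close>, continued through the poles; the case distinction is needed
  because \<^const>\<open>Gamma\<close> is \<open>0\<close> at its poles.\<close>

definition Gamma_quotient :: "nat \<Rightarrow> complex \<Rightarrow> complex" where
  "Gamma_quotient n s =
     (if 1 - s \<in> \<int>\<^sub>\<le>\<^sub>0 \<or> 1 - s + of_nat n \<in> \<int>\<^sub>\<le>\<^sub>0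
      then \<Prod>j=1..n. (of_nat j - s)
      else Gamma (1 - s + of_nat n) / Gamma (1 - s))"

end

theory Submission
  imports Defs
begin

text \<open>
  The rise function is a homeomorphism of the half-line, so \<open>t = J \<theta>\<close> is a coordinate on
  the curve.  In it the \<open>F\<^sup>\<alpha>\<close>-derivative of \<open>f\<close> is the ordinary derivative of
  \<open>g t = f (w t)\<close>, where \<open>w\<close> is the parametrization by mass
  (\<open>has_F_derivative_imp_has_vector_derivative\<close>), and the fractal integral of a function
  continuous in \<open>t\<close> is an ordinary integral (\<open>F_integral_eq_integral\<close>): by the mean value theorem
  it lies between all lower and all upper sums.  The Mellin transform of \<open>f\<close> thereby becomes the
  classical one of \<open>g\<close> (\<open>mellin_eq_Lebesgue_integral\<close>), and the claim becomes
  \<open>\<integral> g\<^sup>(\<^sup>n\<^sup>) t\<^sup>s\<^sup>-\<^sup>1 = (1 - s) \<dots> (n - s) \<integral> g t\<^sup>s\<^sup>-\<^sup>n\<^sup>-\<^sup>1\<close>, both integrals taken over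
  the positive half-line and absolutely convergent.

  Integrating by parts \<open>n\<close> times would produce boundary terms at \<open>0\<close> and \<open>\<infinity>\<close> that involve the
  intermediate derivatives, about whose growth nothing is assumed.  They are avoided by averaging
  over dilations (\<open>mellin_integral_iterated_derivative\<close>).  Let
  \<open>p x = ((x - 1) (b - x))\<^sup>n\<close>, which vanishes to order \<open>n\<close> at the ends of \<open>[1, b]\<close>.  For every
  \<open>r > 0\<close>, integration by parts on \<open>[1, b]\<close> leaves no boundary terms and gives
  \<open>r\<^sup>n \<integral> g\<^sup>(\<^sup>n\<^sup>)(r x) p x dx = (-1)\<^sup>n \<integral> g (r x) p\<^sup>(\<^sup>n\<^sup>) x dx\<close>.
  Multiply by \<open>r\<^sup>s\<^sup>-\<^sup>n\<^sup>-\<^sup>1\<close> and integrate over \<open>r > 0\<close>.  By Fubini and the substitution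
  \<open>t = r x\<close> the two sides factor into the two Mellin integrals, multiplied respectively by
  \<open>\<Phi> = \<integral> x\<^sup>-\<^sup>s p x dx\<close> and \<open>(-1)\<^sup>n \<integral> x\<^sup>n\<^sup>-\<^sup>s p\<^sup>(\<^sup>n\<^sup>) x dx\<close>.
  The same integration by parts, now applied to the power \<open>x\<^sup>n\<^sup>-\<^sup>s\<close>, shows that the second
  constant is \<open>(1 - s) \<dots> (n - s) \<Phi>\<close>.  For \<open>b\<close> close to \<open>1\<close> the real part of \<open>x\<^sup>-\<^sup>s\<close>
  is positive on \<open>[1, b]\<close>, so \<open>\<Phi> \<noteq> 0\<close> can be cancelled.
\<close>

section \<open>Integration by parts without boundary terms\<close>

text \<open>A root of multiplicity \<open>n\<close> loses at most one order per differentiation; applied to the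
  quadratic with roots \<open>a\<close> and \<open>b\<close>, this treats both ends of the interval at once.\<close>

lemma power_dvd_higher_pderiv:
  fixes q p :: "'a::idom poly"
  assumes "q ^ n dvd p" "k \<le> n"
  shows "q ^ (n - k) dvd (pderiv ^^ k) p"
  using assms(2)
proof (induction k)
  case 0
  then show ?case using assms(1) by simp
next
  case (Suc k)
  define m where "m = n - Suc k"
  have "n - k = Suc m" using Suc.prems by (simp add: m_def)
  then obtain r where "(pderiv ^^ k) p = q ^ Suc m * r"
    using Suc by (auto elim: dvdE)
  then have "(pderiv ^^ Suc k) p = q ^ Suc m * pderiv r + r * pderiv (q ^ Suc m)"
    by (simp only: funpow.simps o_apply pderiv_mult)
  also have "\<dots> = q ^ m * (q * pderiv r + r * smult (of_nat (Suc m)) (pderiv q))"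
    unfolding pderiv_power_Suc by (simp add: algebra_simps del: of_nat_Suc)
  finally have "(pderiv ^^ Suc k) p = \<dots>" .
  then show ?case unfolding m_def by (metis dvd_triv_left)
qed

definition bump_poly :: "nat \<Rightarrow> real \<Rightarrow> real \<Rightarrow> real poly" where
  "bump_poly n a b = ([:-a, 1:] * [:b, -1:]) ^ n"

lemma poly_bump_poly: "poly (bump_poly n a b) x = ((x - a) * (b - x)) ^ n"
  by (simp add: bump_poly_def algebra_simps)

lemma bump_poly_endpoints:
  assumes "k < n"
  shows "poly ((pderiv ^^ k) (bump_poly n a b)) a = 0"
    and "poly ((pderiv ^^ k) (bump_poly n a b)) b = 0"
proof -
  let ?q = "[:-a, 1:] * [:b, -1:]"
  have "?q ^ (n - k) dvd (pderiv ^^ k) (bump_poly n a b)"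
    using assms by (intro power_dvd_higher_pderiv) (auto simp: bump_poly_def)
  then obtain r where r: "(pderiv ^^ k) (bump_poly n a b) = ?q ^ (n - k) * r"
    by (elim dvdE)
  show "poly ((pderiv ^^ k) (bump_poly n a b)) a = 0"
    "poly ((pderiv ^^ k) (bump_poly n a b)) b = 0"
    using assms unfolding r by (simp_all add: power_0_left)
qed

text \<open>The derivatives of \<open>p\<close> of order below \<open>n\<close> vanish at both ends, so that none of the \<open>n\<close>
  integrations by parts contributes a boundary term.\<close>

lemma repeated_integration_by_parts:
  fixes G :: "nat \<Rightarrow> real \<Rightarrow> complex" and p :: "real poly"
  assumes "a \<le> b"
    and "\<And>k x. k < n \<Longrightarrow> x \<in> {a..b} \<Longrightarrow> (G k has_vector_derivative G (Suc k) x) (at x)"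
    and "continuous_on {a..b} (G n)"
    and "\<And>k. k < n \<Longrightarrow> poly ((pderiv ^^ k) p) a = 0"
    and "\<And>k. k < n \<Longrightarrow> poly ((pderiv ^^ k) p) b = 0"
  shows "integral {a..b} (\<lambda>x. G n x * of_real (poly p x)) =
    (-1) ^ n * integral {a..b} (\<lambda>x. G 0 x * of_real (poly ((pderiv ^^ n) p) x))"
  using assms
proof (induction n arbitrary: p)
  case 0
  then show ?case by simp
next
  case (Suc n)
  have cont: "continuous_on {a..b} (G n)"
    using Suc.prems(2)[of n]
    by (meson continuous_at_imp_continuous_on has_vector_derivative_continuous lessI)
  have int: "(\<lambda>x. G n x * of_real (poly (pderiv p) x)) integrable_on {a..b}"
    by (intro integrable_continuous_interval continuous_intros cont)
  have "((\<lambda>x. G (Suc n) x * of_real (poly p x)) has_integral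
      - integral {a..b} (\<lambda>x. G n x * of_real (poly (pderiv p) x))) {a..b}"
  proof (rule integration_by_parts[OF bounded_bilinear_mult \<open>a \<le> b\<close> cont])
    show "continuous_on {a..b} (\<lambda>x. complex_of_real (poly p x))"
      by (intro continuous_intros)
    show "(G n has_vector_derivative G (Suc n) x) (at x)" if "x \<in> {a..b}" for x
      using Suc.prems(2) that by simp
    show "((\<lambda>x. complex_of_real (poly p x)) has_vector_derivative
        complex_of_real (poly (pderiv p) x)) (at x)" for x
      by (intro has_vector_derivative_of_real) (simp add: poly_DERIV)
    show "((\<lambda>x. G n x * of_real (poly (pderiv p) x)) has_integral
       G n b * of_real (poly p b) - G n a * of_real (poly p a) -
       - integral {a..b} (\<lambda>x. G n x * of_real (poly (pderiv p) x))) {a..b}"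
      using integrable_integral[OF int] Suc.prems(4)[of 0] Suc.prems(5)[of 0] by simp
  qed
  then have "integral {a..b} (\<lambda>x. G (Suc n) x * of_real (poly p x)) =
      - integral {a..b} (\<lambda>x. G n x * of_real (poly (pderiv p) x))"
    by (rule integral_unique)
  also have "integral {a..b} (\<lambda>x. G n x * of_real (poly (pderiv p) x)) =
      (-1) ^ n * integral {a..b} (\<lambda>x. G 0 x * of_real (poly ((pderiv ^^ n) (pderiv p)) x))"
  proof (rule Suc.IH[OF \<open>a \<le> b\<close> _ cont])
    show "(G k has_vector_derivative G (Suc k) x) (at x)" if "k < n" "x \<in> {a..b}" for k x
      using Suc.prems(2) that by simp
    show "poly ((pderiv ^^ k) (pderiv p)) a = 0" "poly ((pderiv ^^ k) (pderiv p)) b = 0"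
      if "k < n" for k
      using Suc.prems(4)[of "Suc k"] Suc.prems(5)[of "Suc k"] that by (simp_all add: funpow_swap1)
  qed
  finally show ?case by (simp add: funpow_swap1)
qed

section \<open>Complex powers of positive reals\<close>

lemma complex_powr_has_vector_derivative:
  fixes c :: complex
  assumes "x > 0"
  shows "((\<lambda>x. of_real x powr c) has_vector_derivative c * of_real x powr (c - 1)) (at x)"
  using has_vector_derivative_real_field[OF has_field_derivative_powr[of "of_real x" c]] assms
  by simp

lemma real_powr_iterated_derivative:
  fixes c :: complex
  assumes "x > 0"
  shows "((\<lambda>x. (\<Prod>j<k. c - of_nat j) * of_real x powr (c - of_nat k)) has_vector_derivative
    (\<Prod>j<Suc k. c - of_nat j) * of_real x powr (c - of_nat (Suc k))) (at x)"
proof -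
  have "((\<lambda>x. (\<Prod>j<k. c - of_nat j) * of_real x powr (c - of_nat k)) has_vector_derivative
     (\<Prod>j<k. c - of_nat j) * ((c - of_nat k) * of_real x powr (c - of_nat k - 1))) (at x)"
    by (intro has_vector_derivative_mult_right complex_powr_has_vector_derivative assms)
  then show ?thesis by (simp add: algebra_simps)
qed

lemma continuous_on_complex_powr_pos:
  assumes "\<And>x. x \<in> S \<Longrightarrow> 0 < x"
  shows "continuous_on S (\<lambda>x. complex_of_real x powr c)"
proof (rule continuous_at_imp_continuous_on, rule ballI)
  fix x assume "x \<in> S"
  then show "isCont (\<lambda>x. complex_of_real x powr c) x"
    using complex_powr_has_vector_derivative[of x c] assms has_vector_derivative_continuous by blast
qed

lemma powr_times_real_pos:
  assumes "x > 0" "y > 0"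
  shows "complex_of_real (x * y) powr c = of_real x powr c * of_real y powr c"
  using assms by (simp add: powr_times_real)

section \<open>Mellin integrals and averages over dilations\<close>

text \<open>Fubini followed by the substitution \<open>t = x * r\<close> in the inner integral, whose Jacobian is the
  factor \<open>1 / x\<close>; absolute convergence in \<open>r\<close> is inherited from \<open>F\<close> by the same
  substitution, with a bound uniform for \<open>x\<close> in the compact interval away from \<open>0\<close>.\<close>

lemma dilation_average:
  fixes F \<psi> :: "real \<Rightarrow> complex"
  assumes F: "integrable lborel F" and \<psi>: "continuous_on {a..b} \<psi>" and a: "0 < a"
  shows "(LBINT r. LBINT x:{a..b}. \<psi> x * F (x * r)) = (LBINT x:{a..b}. \<psi> x / of_real x) * (LBINT t. F t)"
proof -
  define f where "f x r = (indicator {a..b} x *\<^sub>R \<psi> x) * F (x * r)" for x r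
  have F_int: "integrable lborel (\<lambda>r. F (x * r))"
    and F_eq: "(LBINT r. F (x * r)) = (1 / of_real x) * (LBINT t. F t)"
    and F_norm: "(LBINT r. norm (F (x * r))) = (LBINT t. norm (F t)) / x" if "x > 0" for x
    using that lborel_integrable_real_affine[OF F, of x 0] lborel_integral_real_affine[of x F 0]
      lborel_integral_real_affine[of x "\<lambda>t. norm (F t)" 0]
    by (simp_all add: field_simps scaleR_conv_of_real)
  have \<psi>m: "(\<lambda>x. indicator {a..b} x *\<^sub>R \<psi> x) \<in> borel_measurable borel"
    using \<psi> by (intro borel_measurable_continuous_on_indicator) auto
  have meas: "case_prod f \<in> borel_measurable (lborel \<Otimes>\<^sub>M lborel)"
  proof -
    have [measurable]: "F \<in> borel_measurable borel" using F by simp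
    note \<psi>m[measurable]
    show ?thesis unfolding f_def by measurable
  qed
  have "integrable (lborel \<Otimes>\<^sub>M lborel) (case_prod f)"
  proof (rule lborel_pair.Fubini_integrable[OF meas])
    have "integrable lborel (\<lambda>x. indicator {a..b} x *\<^sub>R (norm (\<psi> x) * ((LBINT t. norm (F t)) / x)))"
      using a by (intro borel_integrable_compact continuous_intros \<psi>) auto
    also have "(\<lambda>x. indicator {a..b} x *\<^sub>R (norm (\<psi> x) * ((LBINT t. norm (F t)) / x))) =
        (\<lambda>x. LBINT r. norm (case_prod f (x, r)))"
      using a by (auto simp: f_def fun_eq_iff norm_mult F_norm indicator_def)
    finally show "integrable lborel (\<lambda>x. LBINT r. norm (case_prod f (x, r)))" .
    show "AE x in lborel. integrable lborel (\<lambda>r. case_prod f (x, r))"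
      using a F_int by (intro AE_I2) (auto simp: f_def indicator_def)
  qed
  then have "(LBINT r. LBINT x. f x r) = (LBINT x. LBINT r. f x r)"
    by (rule lborel_pair.Fubini_integral)
  also have "\<dots> = (LBINT x. (indicator {a..b} x *\<^sub>R (\<psi> x / of_real x)) * (LBINT t. F t))"
    using a by (intro Bochner_Integration.integral_cong) (auto simp: f_def F_eq indicator_def)
  also have "\<dots> = (LBINT x:{a..b}. \<psi> x / of_real x) * (LBINT t. F t)"
    by (simp only: integral_mult_left_zero set_lebesgue_integral_def)
  finally show ?thesis by (simp add: f_def set_lebesgue_integral_def)
qed

text \<open>Averaging the dilates of \<open>H\<close> against \<open>\<phi>\<close> multiplies its Mellin integral by a constant that
  does not depend on \<open>H\<close>, since a dilation by \<open>x\<close> multiplies it by \<open>x powr (- c)\<close>.\<close>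

lemma mellin_dilation_average:
  fixes H \<phi> :: "real \<Rightarrow> complex"
  assumes int: "set_integrable lborel {0<..} (\<lambda>t. H t * of_real t powr (c - 1))"
    and H: "continuous_on {0<..} H" and \<phi>: "continuous_on {a..b} \<phi>" and a: "0 < a"
  shows "(LBINT r:{0<..}. of_real r powr (c - 1) * integral {a..b} (\<lambda>x. H (r * x) * \<phi> x)) =
    integral {a..b} (\<lambda>x. of_real x powr (- c) * \<phi> x) * (LBINT t:{0<..}. H t * of_real t powr (c - 1))"
proof -
  define F where "F t = indicator {0<..} t *\<^sub>R (H t * of_real t powr (c - 1))" for t
  define \<psi> where "\<psi> x = of_real x powr (1 - c) * \<phi> x" for x
  have F: "integrable lborel F" using int by (simp add: F_def[abs_def] set_integrable_def)
  have \<psi>: "continuous_on {a..b} \<psi>"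
    unfolding \<psi>_def using a by (intro continuous_intros continuous_on_complex_powr_pos \<phi>) auto
  have eq: "indicator {0<..} r *\<^sub>R (of_real r powr (c - 1) * integral {a..b} (\<lambda>x. H (r * x) * \<phi> x)) =
      (LBINT x:{a..b}. \<psi> x * F (x * r))" for r
  proof (cases "r > 0")
    case True
    have "of_real x powr (1 - c) * of_real (x * r) powr (c - 1) = complex_of_real r powr (c - 1)"
      if "x > 0" for x
    proof -
      have "of_real x powr (1 - c) * complex_of_real x powr (c - 1) = 1"
        using that by (subst powr_add[symmetric]) simp
      then show ?thesis
        unfolding powr_times_real_pos[OF that True] mult.assoc[symmetric] by simp
    qed
    note cancel = this
    have F_scaled: "\<psi> x * F (x * r) = of_real r powr (c - 1) * (H (r * x) * \<phi> x)" if "x > 0" for x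
      using that True cancel[OF that] unfolding \<psi>_def F_def
      by (simp add: mult.commute[of r])
    have "(LBINT x:{a..b}. \<psi> x * F (x * r)) =
        (LBINT x:{a..b}. of_real r powr (c - 1) * (H (r * x) * \<phi> x))"
      using a F_scaled by (intro set_lebesgue_integral_cong) auto
    also have "\<dots> = of_real r powr (c - 1) * (LBINT x:{a..b}. H (r * x) * \<phi> x)"
      by simp
    also have "(LBINT x:{a..b}. H (r * x) * \<phi> x) = integral {a..b} (\<lambda>x. H (r * x) * \<phi> x)"
      using a True less_le_trans[OF mult_pos_pos[OF True a]]
      by (intro set_borel_integral_eq_integral borel_integrable_atLeastAtMost' continuous_intros
          continuous_on_compose2[OF H] \<phi>) auto
    finally show ?thesis using True by simp
  next
    case False
    then have "(LBINT x:{a..b}. \<psi> x * F (x * r)) = (LBINT x:{a..b}. 0)"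
      using a by (intro set_lebesgue_integral_cong) (auto simp: F_def zero_less_mult_iff)
    then show ?thesis using False by (simp add: set_lebesgue_integral_def)
  qed
  have "(LBINT r:{0<..}. of_real r powr (c - 1) * integral {a..b} (\<lambda>x. H (r * x) * \<phi> x)) =
      (LBINT r. LBINT x:{a..b}. \<psi> x * F (x * r))"
    by (subst set_lebesgue_integral_def) (simp only: eq)
  also have "\<dots> = (LBINT x:{a..b}. \<psi> x / of_real x) * (LBINT t. F t)"
    by (rule dilation_average[OF F \<psi> a])
  also have "(LBINT t. F t) = (LBINT t:{0<..}. H t * of_real t powr (c - 1))"
    by (simp add: set_lebesgue_integral_def F_def)
  also have "(LBINT x:{a..b}. \<psi> x / of_real x) = (LBINT x:{a..b}. of_real x powr (- c) * \<phi> x)"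
    using a by (intro set_lebesgue_integral_cong)
      (auto simp: \<psi>_def powr_diff powr_minus field_simps)
  also have "\<dots> = integral {a..b} (\<lambda>x. of_real x powr (- c) * \<phi> x)"
    using a by (intro set_borel_integral_eq_integral borel_integrable_atLeastAtMost' continuous_intros
        continuous_on_complex_powr_pos \<phi>) auto
  finally show ?thesis .
qed

section \<open>The Mellin integral of an iterated derivative\<close>

text \<open>Near \<open>x = 1\<close> the power is close to \<open>1\<close>, hence has positive real part, and the bump is
  positive inside a short interval \<open>[1, b]\<close>.\<close>

lemma bump_moment_nonzero:
  fixes c :: complex
  obtains b where "1 < b" "integral {1..b} (\<lambda>x. of_real x powr c * of_real (poly (bump_poly n 1 b) x)) \<noteq> 0"
proof -
  have "isCont (\<lambda>x. complex_of_real x powr c) 1"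
    using complex_powr_has_vector_derivative[of 1 c] has_vector_derivative_continuous by auto
  then have "((\<lambda>x. Re (complex_of_real x powr c)) \<longlongrightarrow> 1) (at 1)"
    unfolding isCont_def by (auto dest: tendsto_Re)
  then have "eventually (\<lambda>x. Re (complex_of_real x powr c) > 0) (at 1)"
    by (rule order_tendstoD) simp
  then obtain d where d: "d > 0" "\<And>x. x \<noteq> 1 \<Longrightarrow> dist x 1 < d \<Longrightarrow> Re (complex_of_real x powr c) > 0"
    unfolding eventually_at by blast
  define b where "b = 1 + d / 2"
  have b: "1 < b" using d by (simp add: b_def)
  have pos: "Re (complex_of_real x powr c) > 0" if "x \<in> {1..b}" for x
    using that d by (cases "x = 1") (auto simp: dist_real_def b_def)
  let ?f = "\<lambda>x. Re (of_real x powr c * of_real (poly (bump_poly n 1 b) x))"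
  have cont: "continuous_on {1..b} (\<lambda>x. complex_of_real x powr c * of_real (poly (bump_poly n 1 b) x))"
    by (intro continuous_intros continuous_on_complex_powr_pos) auto
  have f_nonneg: "?f x \<ge> 0" if "x \<in> {1..b}" for x
    using pos[OF that] that by (simp add: poly_bump_poly)
  have "integral {1..b} ?f \<noteq> 0"
  proof
    assume "integral {1..b} ?f = 0"
    then have "(?f has_integral 0) (cbox 1 b)"
      using cont by (metis box_real(2) continuous_on_Re integrable_continuous_interval integrable_integral)
    moreover have "(1 + b) / 2 \<in> cbox 1 b" using b by simp
    ultimately have "?f ((1 + b) / 2) = 0"
      using f_nonneg cont b
      by (intro has_integral_0_cbox_imp_0[of 1 b ?f]) (simp_all only: box_real continuous_on_Re, simp_all)
    moreover have "?f ((1 + b) / 2) > 0"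
      using b pos[of "(1 + b) / 2"] by (auto simp: poly_bump_poly intro!: mult_pos_pos zero_less_power)
    ultimately show False by linarith
  qed
  moreover have "integral {1..b} ?f =
      Re (integral {1..b} (\<lambda>x. of_real x powr c * of_real (poly (bump_poly n 1 b) x)))"
    using cont by (intro integral_unique has_integral_Re integrable_integral integrable_continuous_interval)
  ultimately show ?thesis using b that by fastforce
qed

lemma prod_shift_reindex:
  "(\<Prod>j<n. (of_nat n - s) - of_nat j) = (\<Prod>j=1..n. of_nat j - (s :: 'a :: comm_ring_1))"
  by (rule prod.reindex_bij_witness[of _ "\<lambda>j. n - j" "\<lambda>j. n - j"]) (auto simp: of_nat_diff)

text \<open>Averaging over dilations against a bump replaces integration by parts on the half-line,
  whose boundary terms would involve the intermediate derivatives.\<close>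

theorem mellin_integral_iterated_derivative:
  fixes G :: "nat \<Rightarrow> real \<Rightarrow> complex"
  assumes deriv: "\<And>k t. k < n \<Longrightarrow> 0 < t \<Longrightarrow> (G k has_vector_derivative G (Suc k) t) (at t)"
    and cont: "continuous_on {0<..} (G n)"
    and int_n: "set_integrable lborel {0<..} (\<lambda>t. G n t * of_real t powr (s - 1))"
    and int_0: "set_integrable lborel {0<..} (\<lambda>t. G 0 t * of_real t powr (s - of_nat n - 1))"
  shows "(LBINT t:{0<..}. G n t * of_real t powr (s - 1)) =
    (\<Prod>j=1..n. of_nat j - s) * (LBINT t:{0<..}. G 0 t * of_real t powr (s - of_nat n - 1))"
proof -
  obtain b where b: "1 < b"
    and nz: "integral {1..b} (\<lambda>x. of_real x powr (- s) * of_real (poly (bump_poly n 1 b) x)) \<noteq> 0"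
    by (rule bump_moment_nonzero)
  define p where "p = bump_poly n 1 b"
  define q where "q = (pderiv ^^ n) p"
  note p_ends = bump_poly_endpoints[of _ n 1 b, folded p_def]
  have cont_0: "continuous_on {0<..} (G 0)"
  proof (cases "n = 0")
    case False
    then show ?thesis using deriv[of 0]
      by (auto intro!: continuous_at_imp_continuous_on has_vector_derivative_continuous)
  qed (use cont in simp)
  let ?N = "LBINT t:{0<..}. G n t * of_real t powr (s - 1)"
  let ?M = "LBINT t:{0<..}. G 0 t * of_real t powr (s - of_nat n - 1)"
  let ?\<Phi> = "integral {1..b} (\<lambda>x. of_real x powr (- s) * of_real (poly p x))"
  let ?\<Psi> = "integral {1..b} (\<lambda>x. of_real x powr (- (s - of_nat n)) * of_real (poly q x))"
  \<comment> \<open>Integration by parts for the dilate \<open>x \<mapsto> g (r x)\<close>, whose \<open>k\<close>-th derivative is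
    \<open>r ^ k * G k (r * x)\<close>.\<close>
  have scaled: "of_real r powr (s - 1) * integral {1..b} (\<lambda>x. G n (r * x) * of_real (poly p x)) =
      (-1) ^ n * (of_real r powr (s - of_nat n - 1) *
        integral {1..b} (\<lambda>x. G 0 (r * x) * of_real (poly q x)))" if r: "r > 0" for r
  proof -
    have "((\<lambda>x. of_real r ^ k * G k (r * x)) has_vector_derivative
        of_real r ^ Suc k * G (Suc k) (r * x)) (at x)" if "k < n" "x \<in> {1..b}" for k x
    proof -
      have "((G k \<circ> (\<lambda>x. r * x)) has_vector_derivative r *\<^sub>R G (Suc k) (r * x)) (at x)"
        using r that deriv
        by (intro vector_diff_chain_at) (auto intro!: derivative_eq_intros)
      then have "((\<lambda>x. of_real r ^ k * G k (r * x)) has_vector_derivative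
          of_real r ^ k * (r *\<^sub>R G (Suc k) (r * x))) (at x)"
        by (intro has_vector_derivative_mult_right) (simp add: o_def)
      then show ?thesis by (simp add: scaleR_conv_of_real mult_ac)
    qed
    moreover have "continuous_on {1..b} (\<lambda>x. of_real r ^ n * G n (r * x))"
      using r by (intro continuous_intros continuous_on_compose2[OF cont]) auto
    ultimately have "integral {1..b} (\<lambda>x. of_real r ^ n * G n (r * x) * of_real (poly p x)) =
        (-1) ^ n * integral {1..b} (\<lambda>x. of_real r ^ 0 * G 0 (r * x) * of_real (poly q x))"
      unfolding q_def using b p_ends by (intro repeated_integration_by_parts) auto
    moreover have "of_real r powr (s - 1) = of_real r powr (s - of_nat n - 1) * complex_of_real r ^ n"
      using r powr_add[of "of_real r" "s - of_nat n - 1" "of_nat n"] by simp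
    ultimately show ?thesis by (simp add: mult.assoc mult.left_commute)
  qed
  have "?\<Phi> * ?N = (LBINT r:{0<..}. of_real r powr (s - 1) *
      integral {1..b} (\<lambda>x. G n (r * x) * of_real (poly p x)))"
    by (rule mellin_dilation_average[symmetric]) (auto intro!: int_n cont continuous_intros)
  also have "\<dots> = (LBINT r:{0<..}. (-1) ^ n * (of_real r powr (s - of_nat n - 1) *
      integral {1..b} (\<lambda>x. G 0 (r * x) * of_real (poly q x))))"
    using scaled by (intro set_lebesgue_integral_cong) auto
  also have "\<dots> = (-1) ^ n * (LBINT r:{0<..}. of_real r powr (s - of_nat n - 1) *
      integral {1..b} (\<lambda>x. G 0 (r * x) * of_real (poly q x)))"
    by simp
  also have "(LBINT r:{0<..}. of_real r powr (s - of_nat n - 1) *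
      integral {1..b} (\<lambda>x. G 0 (r * x) * of_real (poly q x))) = ?\<Psi> * ?M"
    by (rule mellin_dilation_average) (auto intro!: int_0 cont_0 continuous_intros)
  finally have transfer: "?\<Phi> * ?N = ((-1) ^ n * ?\<Psi>) * ?M" by simp
  \<comment> \<open>The quotient of the two constants is found by testing with the power \<open>x powr (n - s)\<close>,
    whose \<open>k\<close>-th derivative is \<open>P k\<close>.\<close>
  define P where "P k x = (\<Prod>j<k. (of_nat n - s) - of_nat j) * complex_of_real x powr (of_nat n - s - of_nat k)" for k x
  have "integral {1..b} (\<lambda>x. P n x * of_real (poly p x)) =
      (-1) ^ n * integral {1..b} (\<lambda>x. P 0 x * of_real (poly q x))"
    unfolding q_def
  proof (rule repeated_integration_by_parts)
    show "(P k has_vector_derivative P (Suc k) x) (at x)" if "x \<in> {1..b}" for k x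
      unfolding P_def using that by (intro real_powr_iterated_derivative) auto
    show "continuous_on {1..b} (P n)"
      unfolding P_def by (intro continuous_intros continuous_on_complex_powr_pos) auto
  qed (use b p_ends in auto)
  also have "integral {1..b} (\<lambda>x. P 0 x * of_real (poly q x)) = ?\<Psi>"
    by (simp add: P_def)
  also have "integral {1..b} (\<lambda>x. P n x * of_real (poly p x)) = (\<Prod>j=1..n. of_nat j - s) * ?\<Phi>"
    by (simp add: P_def prod_shift_reindex mult.assoc)
  finally have "?\<Phi> * ?N = ?\<Phi> * ((\<Prod>j=1..n. of_nat j - s) * ?M)"
    by (simp add: transfer mult.left_commute mult.assoc)
  then show ?thesis using nz by (simp add: p_def)
qed

text \<open>Away from the poles both sides are the rising factorial of \<open>1 - s\<close>.\<close>

lemma Gamma_quotient_eq_prod: "Gamma_quotient n s = (\<Prod>j=1..n. of_nat j - s)"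
proof (cases "1 - s \<in> \<int>\<^sub>\<le>\<^sub>0")
  case False
  have "(\<Prod>j=1..n. of_nat j - s) = pochhammer (1 - s) n"
    unfolding pochhammer_prod
    by (rule prod.reindex_bij_witness[of _ "\<lambda>j. j + 1" "\<lambda>j. j - 1"]) (auto simp: of_nat_diff)
  then show ?thesis using False by (simp add: Gamma_quotient_def pochhammer_Gamma)
qed (simp add: Gamma_quotient_def)

section \<open>Subdivisions and Darboux sums\<close>

lemma subdivision_mono:
  assumes "(N, z) \<in> subdivisions a b" "i \<le> j" "j \<le> N"
  shows "z i \<le> z j"
  using assms(2,3)
proof (induction j rule: dec_induct)
  case (step k)
  then have "z i \<le> z k" "z k < z (Suc k)" using assms(1) by (auto simp: subdivisions_def)
  then show ?case by simp
qed simp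

lemma uniform_subdivision:
  fixes a b \<delta> :: real
  assumes "a < b" "0 < \<delta>"
  obtains N z where "(N, z) \<in> subdivisions a b" "\<And>i. z (Suc i) - z i < \<delta>"
proof -
  obtain N where N: "(b - a) / \<delta> < real N" using reals_Archimedean2 by blast
  then have "0 < real N" using assms by (smt (verit) divide_pos_pos)
  define z where "z i = a + real i * ((b - a) / real N)" for i
  have step: "z (Suc i) - z i = (b - a) / real N" for i
    by (simp add: z_def distrib_right add_divide_distrib)
  have "z i < z (Suc i)" for i
    using step[of i] \<open>0 < real N\<close> \<open>a < b\<close> by (smt (verit) divide_pos_pos)
  then have "(N, z) \<in> subdivisions a b"
    using \<open>0 < real N\<close> by (auto simp: subdivisions_def) (auto simp: z_def)
  moreover have "z (Suc i) - z i < \<delta>" for i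
    using N \<open>0 < real N\<close> \<open>0 < \<delta>\<close> unfolding step by (simp add: field_simps)
  ultimately show ?thesis by (rule that)
qed

text \<open>The form in which lower and upper Darboux sums determine the integral.\<close>

lemma SUP_eq_INF_squeeze:
  fixes L U :: "'a \<Rightarrow> real"
  assumes "\<And>P. P \<in> S \<Longrightarrow> L P \<le> I" "\<And>P. P \<in> S \<Longrightarrow> I \<le> U P"
    and "\<And>e. 0 < e \<Longrightarrow> \<exists>P\<in>S. I - e \<le> L P \<and> U P \<le> I + e"
  shows "(SUP P\<in>S. L P) = I" and "(INF P\<in>S. U P) = I"
proof -
  have "S \<noteq> {}" using assms(3)[of 1] by auto
  have bdd: "bdd_above (L ` S)" "bdd_below (U ` S)"
    using assms(1,2) by (auto intro!: bdd_aboveI bdd_belowI)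
  show "(SUP P\<in>S. L P) = I"
  proof (rule antisym)
    show "(SUP P\<in>S. L P) \<le> I" using \<open>S \<noteq> {}\<close> assms(1) by (rule cSUP_least)
    show "I \<le> (SUP P\<in>S. L P)"
    proof (rule field_le_epsilon)
      fix e :: real assume "0 < e"
      then obtain P where "P \<in> S" "I - e \<le> L P" using assms(3) by blast
      then show "I \<le> (SUP P\<in>S. L P) + e" using cSUP_upper[OF _ bdd(1), of P] by simp
    qed
  qed
  show "(INF P\<in>S. U P) = I"
  proof (rule antisym)
    show "I \<le> (INF P\<in>S. U P)" using \<open>S \<noteq> {}\<close> assms(2) by (rule cINF_greatest)
    show "(INF P\<in>S. U P) \<le> I"
    proof (rule field_le_epsilon)
      fix e :: real assume "0 < e"
      then obtain P where "P \<in> S" "U P \<le> I + e" using assms(3) by blast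
      then show "(INF P\<in>S. U P) \<le> I + e" using cINF_lower[OF bdd(2), of P] by simp
    qed
  qed
qed

section \<open>Integrability on the half-line from bounded integrals\<close>

text \<open>The integrals over the exhausting intervals \<open>[1 / (i + 2), i + 2]\<close> increase and are bounded,
  hence converge.\<close>

lemma set_integrable_of_bounded_integrals:
  fixes g :: "real \<Rightarrow> real"
  assumes cont: "continuous_on {0<..} g" and nonneg: "\<And>t. 0 < t \<Longrightarrow> 0 \<le> g t"
    and bound: "\<And>a b. 0 < a \<Longrightarrow> a < 1 \<Longrightarrow> 1 < b \<Longrightarrow> integral {a..b} g \<le> C"
  shows "set_integrable lborel {0<..} g"
proof -
  define l u where "l i = 1 / (real i + 2)" and "u i = real i + 2" for i :: nat
  have lu: "0 < l i" "l i < 1" "1 < u i" for i by (simp_all add: l_def u_def)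
  have int: "set_integrable lborel {a..b} g" if "0 < a" for a b
    using that by (intro borel_integrable_atLeastAtMost' continuous_on_subset[OF cont]) auto
  define I where "I i = integral {l i..u i} g" for i
  have l_dec: "decseq l" by (auto simp: decseq_def l_def frac_le)
  have u_inc: "incseq u" by (auto simp: incseq_def u_def)
  have "incseq I"
  proof (rule incseq_SucI)
    fix i
    have "l (Suc i) \<le> l i" "u i \<le> u (Suc i)"
      using l_dec u_inc by (auto simp: decseq_Suc_iff incseq_Suc_iff)
    then show "I i \<le> I (Suc i)"
      unfolding I_def using lu set_borel_integral_eq_integral(1)[OF int]
      by (intro integral_subset_le) (auto intro!: nonneg less_le_trans[OF lu(1)[of "Suc i"]])
  qed
  moreover have "\<forall>i. I i \<le> C" unfolding I_def using lu by (blast intro: bound)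
  ultimately obtain L where L: "I \<longlonglongrightarrow> L" by (rule incseq_convergent)
  have l_lim: "l \<longlonglongrightarrow> 0" unfolding l_def by real_asymp
  have u_lim: "filterlim u at_top sequentially" unfolding u_def by real_asymp
  have ein: "einterval 0 \<infinity> = {0<..}" by (auto simp: einterval_def)
  have "set_integrable lborel (einterval 0 \<infinity>) g"
  proof (rule interval_integral_Icc_approx_nonneg(1)[where l = l and u = u and C = L])
    show "einterval 0 \<infinity> = (\<Union>i. {l i..u i})"
    proof (intro set_eqI iffI)
      fix x assume "x \<in> einterval 0 \<infinity>"
      then have "0 < x" by (simp add: ein)
      then have "\<forall>\<^sub>F i in sequentially. l i < x \<and> x < u i"
        using order_tendstoD(2)[OF l_lim] filterlim_at_top_dense[THEN iffD1, OF u_lim]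
        by (auto intro: eventually_conj)
      then obtain i where "l i < x" "x < u i"
        unfolding eventually_sequentially by blast
      then show "x \<in> (\<Union>i. {l i..u i})" by (intro UN_I[of i]) auto
    qed (use lu in \<open>auto simp: ein intro: less_le_trans\<close>)
    show "set_borel_measurable lborel (einterval 0 \<infinity>) g"
      unfolding set_borel_measurable_def ein
      using borel_measurable_continuous_on_indicator[OF _ cont] by simp
    show "(\<lambda>i. LBINT x=ereal (l i)..ereal (u i). g x) \<longlonglongrightarrow> L"
    proof -
      have "(LBINT x=ereal (l i)..ereal (u i). g x) = I i" for i
        unfolding I_def using lu[of i] int[of "l i" "u i"]
        by (subst interval_integral_eq_integral) auto
      then show ?thesis using L by simp
    qed
    show "(\<lambda>i. ereal (l i)) \<longlonglongrightarrow> 0" using l_lim by (simp add: zero_ereal_def)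
    show "(\<lambda>i. ereal (u i)) \<longlonglongrightarrow> \<infinity>" using u_lim by (simp add: tendsto_PInfty_eq_at_top)
    show "l i < u i" for i using lu[of i] by linarith
  qed (use lu nonneg l_dec u_inc int in auto)
  then show ?thesis by (simp add: ein)
qed

section \<open>Parametrization of the curve by mass\<close>

locale fractal_curve_by_mass =
  fixes v :: "real \<Rightarrow> real ^ 'd" and \<alpha> :: real
  assumes fractal_curve: "fractal_curve v \<alpha>"
begin

abbreviation \<rho> :: "real \<Rightarrow> real" where "\<rho> \<equiv> rise v \<alpha>"

definition \<tau> :: "real \<Rightarrow> real" where "\<tau> = inv_into {0..} \<rho>"

text \<open>For \<open>t \<ge> 0\<close>, the point of the curve at which \<open>J = t\<close>.\<close>

definition w :: "real \<Rightarrow> real ^ 'd" where "w t = v (\<tau> t)"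

lemma rise_strict_mono: "0 \<le> x \<Longrightarrow> x < y \<Longrightarrow> \<rho> x < \<rho> y"
  using fractal_curve by (auto simp: fractal_curve_def strict_mono_on_def)

lemma rise_mono: "0 \<le> x \<Longrightarrow> x \<le> y \<Longrightarrow> \<rho> x \<le> \<rho> y"
  using rise_strict_mono[of x y] by (cases "x = y") auto

lemma rise_image: "\<rho> ` {0..} = {0..}"
  using fractal_curve by (simp add: fractal_curve_def)

lemma inj_on_rise: "inj_on \<rho> {0..}"
  using fractal_curve by (auto simp: fractal_curve_def intro: strict_mono_on_imp_inj_on)

lemma rise_inv_rise [simp]: "0 \<le> z \<Longrightarrow> \<tau> (\<rho> z) = z"
  by (simp add: \<tau>_def inj_on_rise)

lemma rise_rise_inv [simp]: "0 \<le> t \<Longrightarrow> \<rho> (\<tau> t) = t"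
  by (simp add: \<tau>_def f_inv_into_f rise_image)

lemma rise_inv_nonneg [simp]: "0 \<le> t \<Longrightarrow> 0 \<le> \<tau> t"
  using inv_into_into[of t \<rho> "{0..}"] by (simp add: \<tau>_def rise_image)

lemma rise_nonneg [simp]: "0 \<le> z \<Longrightarrow> 0 \<le> \<rho> z"
  using rise_image by (metis atLeast_iff imageI)

lemma rise_inv_mono: "0 \<le> t \<Longrightarrow> t \<le> u \<Longrightarrow> \<tau> t \<le> \<tau> u"
  using rise_strict_mono[of "\<tau> u" "\<tau> t"] by force

lemma rise_0 [simp]: "\<rho> 0 = 0"
  using rise_mono[of 0 "\<tau> 0"] rise_nonneg[of 0] by (intro antisym) simp_all

lemma rise_inv_0 [simp]: "\<tau> 0 = 0"
  using rise_inv_rise[of 0] by simp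

lemma rise_pos: "0 < z \<Longrightarrow> 0 < \<rho> z"
  using rise_strict_mono[of 0 z] by simp

lemma rise_inv_strict_mono: "0 \<le> t \<Longrightarrow> t < u \<Longrightarrow> \<tau> t < \<tau> u"
  using rise_inv_mono[of t u] rise_rise_inv[of t] rise_rise_inv[of u] by (cases "\<tau> t = \<tau> u") auto

lemma rise_inv_pos: "0 < t \<Longrightarrow> 0 < \<tau> t"
  using rise_inv_strict_mono[of 0 t] by simp

lemma continuous_on_rise: "continuous_on {0..} \<rho>"
  using fractal_curve by (simp add: fractal_curve_def)

lemma rise_inv_in_Icc:
  assumes "0 \<le> a" "a \<le> b" "t \<in> {\<rho> a..\<rho> b}"
  shows "\<tau> t \<in> {a..b}"
proof -
  have "0 \<le> t" using assms order_trans[OF rise_nonneg[of a]] by simp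
  then show ?thesis
    using assms rise_inv_mono[of "\<rho> a" t] rise_inv_mono[of t "\<rho> b"] by simp
qed

lemma rise_image_Icc:
  assumes "0 \<le> a" "a \<le> b"
  shows "\<rho> ` {a..b} = {\<rho> a..\<rho> b}"
proof safe
  fix t assume t: "t \<in> {\<rho> a..\<rho> b}"
  then have "0 \<le> t" using assms order_trans[OF rise_nonneg[of a]] by simp
  then show "t \<in> \<rho> ` {a..b}"
    using rise_inv_in_Icc[OF assms t] by (intro image_eqI[of _ _ "\<tau> t"]) simp_all
qed (use assms in \<open>auto intro: rise_mono\<close>)

text \<open>A continuous bijection from a compact interval has a continuous inverse.\<close>

lemma isCont_rise_inv:
  assumes "0 < t" shows "isCont \<tau> t"
proof -
  let ?b = "\<tau> (t + 1)"
  have "continuous_on {0..?b} \<rho>"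
    using continuous_on_rise by (rule continuous_on_subset) auto
  then have "continuous_on (\<rho> ` {0..?b}) \<tau>"
    by (rule continuous_on_inv) auto
  then have "continuous_on {0..t + 1} \<tau>"
    using assms by (subst (asm) rise_image_Icc) auto
  then show ?thesis
    using assms by (intro continuous_on_interior[of "{0..t + 1}"]) auto
qed

lemma J_param: "0 \<le> z \<Longrightarrow> J v \<alpha> (v z) = \<rho> z"
  using fractal_curve by (simp add: J_def fractal_curve_def)

lemma J_mass_param: "0 \<le> t \<Longrightarrow> J v \<alpha> (w t) = t"
  by (simp add: w_def J_param)

lemma mass_param_rise: "0 \<le> z \<Longrightarrow> w (\<rho> z) = v z"
  by (simp add: w_def)

lemma isCont_mass_param:
  assumes "0 < t" shows "isCont w t"
proof -
  have "continuous_on {0<..} v"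
    using fractal_curve by (auto simp: fractal_curve_def intro: continuous_on_subset)
  then have "isCont v (\<tau> t)"
    using rise_inv_pos[OF assms] by (simp add: continuous_on_eq_continuous_at)
  then show ?thesis
    unfolding w_def[abs_def] using isCont_rise_inv[OF assms] by (rule isCont_o2[rotated])
qed

lemma mass_param_in_curve: "0 < t \<Longrightarrow> w t \<in> curve v - {v 0}"
proof -
  assume "0 < t"
  then have "w t \<noteq> v 0"
    using J_mass_param[of t] J_param[of 0] by auto
  then show ?thesis using \<open>0 < t\<close> by (simp add: curve_def w_def)
qed

lemma continuous_on_mass_param_comp:
  assumes "continuous_on (curve v - {v 0}) h"
  shows "continuous_on {0<..} (\<lambda>t. h (w t))"
  using mass_param_in_curve
  by (intro continuous_on_compose2[OF assms])
    (auto intro!: continuous_at_imp_continuous_on isCont_mass_param)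

text \<open>The curve may return arbitrarily close to \<open>w t\<close> for large parameters, so a limit along the
  curve in the ambient topology can be more restrictive than one in the parameter.  It does imply
  the latter, and this is the direction needed here.\<close>

lemma filterlim_mass_param:
  assumes "0 < t" shows "filterlim w (at (w t) within curve v) (at t)"
  unfolding filterlim_at
proof (intro conjI)
  show "(w \<longlongrightarrow> w t) (at t)" using isCont_mass_param[OF assms] by (simp add: isCont_def)
  have "eventually (\<lambda>t'. t' \<in> {0<..} - {t}) (at t)"
    using assms by (intro eventually_at_in_open) auto
  then show "\<forall>\<^sub>F t' in at t. w t' \<in> curve v \<and> w t' \<noteq> w t"
  proof eventually_elim
    case (elim t')
    then have "w t' \<noteq> w t" using J_mass_param[of t] J_mass_param[of t'] assms by auto
    then show ?case using mass_param_in_curve[of t'] elim by auto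
  qed
qed

lemma has_F_derivative_unique:
  assumes "0 < t" "has_F_derivative v \<alpha> h D (w t)" "has_F_derivative v \<alpha> h D' (w t)"
  shows "D = D'"
proof -
  have "at (w t) within curve v \<noteq> bot"
    using filterlim_mass_param[OF assms(1)] trivial_limit_at[of t]
    by (metis filterlim_def filtermap_bot_iff bot.extremum_uniqueI)
  then show ?thesis
    using assms(2,3) unfolding has_F_derivative_def by (rule tendsto_unique)
qed

lemma F_deriv_eq:
  assumes "0 < t" "has_F_derivative v \<alpha> h D (w t)"
  shows "F_deriv v \<alpha> h (w t) = D"
  unfolding F_deriv_def using assms has_F_derivative_unique by blast

lemma has_F_derivative_imp_has_vector_derivative:
  assumes t: "0 < t" and D: "has_F_derivative v \<alpha> h D (w t)"
  shows "((\<lambda>t. h (w t)) has_vector_derivative D) (at t)"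
proof -
  have "((\<lambda>t'. (h (w t') - h (w t)) / of_real (J v \<alpha> (w t') - J v \<alpha> (w t))) \<longlongrightarrow> D) (at t)"
    using D filterlim_mass_param[OF t] unfolding has_F_derivative_def by (rule filterlim_compose)
  moreover have "\<forall>\<^sub>F t' in at t. (h (w t') - h (w t)) / of_real (J v \<alpha> (w t') - J v \<alpha> (w t)) =
      (h (w t') - h (w t)) / of_real (t' - t)"
    using eventually_at_in_open[of "{0<..}" t] t
    by (auto elim!: eventually_mono simp: J_mass_param)
  ultimately have "((\<lambda>t'. (h (w t') - h (w t)) / of_real (t' - t)) \<longlongrightarrow> D) (at t)"
    by (rule Lim_transform_eventually)
  then have "((\<lambda>t'. norm ((h (w t') - h (w t)) / of_real (t' - t) - D)) \<longlongrightarrow> 0) (at t)"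
    by (intro tendsto_norm_zero) (simp add: LIM_zero)
  moreover have "\<forall>\<^sub>F t' in at t. norm ((h (w t') - h (w t)) / of_real (t' - t) - D) =
      norm (h (w t') - h (w t) - (t' - t) *\<^sub>R D) / norm (t' - t)"
    by (rule eventually_mono[OF eventually_neq_at_within[of t]])
      (simp add: norm_divide[symmetric] scaleR_conv_of_real field_simps flip: norm_of_real[where 'a = complex])
  ultimately have "((\<lambda>t'. norm (h (w t') - h (w t) - (t' - t) *\<^sub>R D) / norm (t' - t)) \<longlongrightarrow> 0) (at t)"
    by (rule Lim_transform_eventually)
  then show ?thesis
    by (simp add: has_vector_derivative_def has_derivative_iff_norm bounded_linear_scaleR_left)
qed

text \<open>\<open>F_deriv\<close> is a definite description; by uniqueness of limits along the curve it denotes the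
  derivative whose existence membership in \<open>C_n\<close> provides.\<close>

lemma C_n_has_vector_derivative:
  assumes "f \<in> C_n v \<alpha> n" "k < n" "0 < t"
  shows "((\<lambda>t. (F_deriv v \<alpha> ^^ k) f (w t)) has_vector_derivative (F_deriv v \<alpha> ^^ Suc k) f (w t)) (at t)"
proof -
  obtain D where D: "has_F_derivative v \<alpha> ((F_deriv v \<alpha> ^^ k) f) D (w t)"
    using assms mass_param_in_curve[of t] unfolding C_n_def by blast
  show ?thesis
    using has_F_derivative_imp_has_vector_derivative[OF assms(3) D] F_deriv_eq[OF assms(3) D] by simp
qed

section \<open>Fractal integrals as ordinary integrals\<close>

text \<open>With \<open>A\<close> a primitive of \<open>h \<circ> w\<close>, the mean value theorem writes the increment of \<open>A\<close> over a
  piece of a subdivision as a value of \<open>h\<close> on that piece times the increment of \<open>J\<close>.  Hence the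
  total increment lies between every lower and every upper sum, and uniform continuity brings both
  sums close to it on fine subdivisions.\<close>

lemma F_integral_eq_integral:
  fixes h :: "real ^ 'd \<Rightarrow> real"
  assumes a: "0 < a" and ab: "a < b" and cont: "continuous_on {0<..} (\<lambda>t. h (w t))"
  shows "F_integrable v \<alpha> h a b" and "F_integral v \<alpha> h a b = integral {\<rho> a..\<rho> b} (\<lambda>t. h (w t))"
proof -
  have "continuous_on {a..b} (\<lambda>z. h (w (\<rho> z)))"
    using a rise_pos continuous_on_rise
    by (intro continuous_on_compose2[OF cont]) (auto intro: continuous_on_subset)
  then have hv: "continuous_on {a..b} (\<lambda>z. h (v z))"
    using a by (subst (asm) continuous_on_cong[OF refl, of _ _ "\<lambda>z. h (v z)"]) (auto simp: mass_param_rise)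
  have bounded: "bounded (h ` v ` {a..b})"
    using compact_continuous_image[OF hv] compact_imp_bounded by (simp add: image_image)
  have bdd: "bdd_below (h ` v ` {x..y})" "bdd_above (h ` v ` {x..y})" if "{x..y} \<subseteq> {a..b}" for x y
    using that bounded bounded_imp_bdd_below bounded_imp_bdd_above bounded_subset
    by (metis image_mono)+
  have \<rho>_ab: "0 < \<rho> a" "\<rho> a < \<rho> b"
    using a ab rise_pos rise_strict_mono by auto
  define A where "A t = integral {\<rho> a..t} (\<lambda>t. h (w t))" for t
  have A: "(A has_vector_derivative h (w t)) (at t within {\<rho> a..\<rho> b})" if "t \<in> {\<rho> a..\<rho> b}" for t
    unfolding A_def using that \<rho>_ab
    by (intro integral_has_vector_derivative continuous_on_subset[OF cont]) auto
  have mean: "\<exists>\<xi>\<in>{x..y}. A (\<rho> y) - A (\<rho> x) = h (v \<xi>) * (\<rho> y - \<rho> x)" if "a \<le> x" "x \<le> y" "y \<le> b" for x y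
  proof -
    have sub: "{\<rho> x..\<rho> y} \<subseteq> {\<rho> a..\<rho> b}" using that a rise_mono by auto
    have "\<exists>t\<in>{\<rho> x..\<rho> y}. A (\<rho> y) - A (\<rho> x) = (\<rho> y - \<rho> x) *\<^sub>R h (w t)"
    proof (rule mvt_very_simple)
      fix t assume "\<rho> x \<le> t" "t \<le> \<rho> y"
      then show "(A has_derivative (\<lambda>d. d *\<^sub>R h (w t))) (at t within {\<rho> x..\<rho> y})"
        using has_vector_derivative_within_subset[OF A sub] sub
        unfolding has_vector_derivative_def by auto
    qed (use that a rise_mono in auto)
    then obtain t where t: "t \<in> {\<rho> x..\<rho> y}" "A (\<rho> y) - A (\<rho> x) = (\<rho> y - \<rho> x) *\<^sub>R h (w t)"
      by blast
    then show ?thesis using that a rise_inv_in_Icc[of x y t]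
      by (intro bexI[of _ "\<tau> t"]) (auto simp: w_def)
  qed
  let ?I = "A (\<rho> b)"
  have range: "a \<le> z i" "z i \<le> z (Suc i)" "z (Suc i) \<le> b"
    if "(N, z) \<in> subdivisions a b" "i < N" for N z i
    using that subdivision_mono[OF that(1), of 0 i] subdivision_mono[OF that(1), of i "Suc i"]
      subdivision_mono[OF that(1), of "Suc i" N] by (auto simp: subdivisions_def)
  have mean_piece: "\<exists>\<xi>\<in>{z i..z (Suc i)}.
      A (\<rho> (z (Suc i))) - A (\<rho> (z i)) = h (v \<xi>) * (\<rho> (z (Suc i)) - \<rho> (z i))"
    if "(N, z) \<in> subdivisions a b" "i < N" for N z i
    by (rule mean[OF range[OF that]])
  have telescope: "(\<Sum>i<N. A (\<rho> (z (Suc i))) - A (\<rho> (z i))) = ?I" if "(N, z) \<in> subdivisions a b" for N z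
    using that sum_lessThan_telescope[of "\<lambda>i. A (\<rho> (z i))" N] by (simp add: subdivisions_def A_def)
  have J_diff: "J v \<alpha> (v (z (Suc i))) - J v \<alpha> (v (z i)) = \<rho> (z (Suc i)) - \<rho> (z i)"
    and J_diff_nonneg: "0 \<le> \<rho> (z (Suc i)) - \<rho> (z i)"
    if "(N, z) \<in> subdivisions a b" "i < N" for N z i
    using range[OF that] a by (simp_all add: J_param rise_mono)
  have lower: "lower_sum v \<alpha> h P \<le> ?I" if P: "P \<in> subdivisions a b" for P
  proof -
    obtain N z where [simp]: "P = (N, z)" by force
    have "lower_sum v \<alpha> h P \<le> (\<Sum>i<N. A (\<rho> (z (Suc i))) - A (\<rho> (z i)))"
      unfolding lower_sum_def
    proof (simp, rule sum_mono)
      fix i assume "i \<in> {..<N}"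
      then have i: "i < N" by simp
      obtain \<xi> where \<xi>: "\<xi> \<in> {z i..z (Suc i)}"
        "A (\<rho> (z (Suc i))) - A (\<rho> (z i)) = h (v \<xi>) * (\<rho> (z (Suc i)) - \<rho> (z i))"
        using mean_piece[of N z i] P i by auto
      have "(INF \<theta>\<in>v ` {z i..z (Suc i)}. h \<theta>) \<le> h (v \<xi>)"
        using \<xi> range[of N z i] P i by (intro cINF_lower bdd) auto
      then show "(INF \<theta>\<in>v ` {z i..z (Suc i)}. h \<theta>) * (J v \<alpha> (v (z (Suc i))) - J v \<alpha> (v (z i)))
          \<le> A (\<rho> (z (Suc i))) - A (\<rho> (z i))"
        using P i J_diff_nonneg by (simp add: J_diff \<xi> mult_right_mono)
    qed
    then show ?thesis using telescope P by simp
  qed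
  have upper: "?I \<le> upper_sum v \<alpha> h P" if P: "P \<in> subdivisions a b" for P
  proof -
    obtain N z where [simp]: "P = (N, z)" by force
    have "(\<Sum>i<N. A (\<rho> (z (Suc i))) - A (\<rho> (z i))) \<le> upper_sum v \<alpha> h P"
      unfolding upper_sum_def
    proof (simp, rule sum_mono)
      fix i assume "i \<in> {..<N}"
      then have i: "i < N" by simp
      obtain \<xi> where \<xi>: "\<xi> \<in> {z i..z (Suc i)}"
        "A (\<rho> (z (Suc i))) - A (\<rho> (z i)) = h (v \<xi>) * (\<rho> (z (Suc i)) - \<rho> (z i))"
        using mean_piece[of N z i] P i by auto
      have "h (v \<xi>) \<le> (SUP \<theta>\<in>v ` {z i..z (Suc i)}. h \<theta>)"
        using \<xi> range[of N z i] P i by (intro cSUP_upper bdd) auto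
      then show "A (\<rho> (z (Suc i))) - A (\<rho> (z i)) \<le>
          (SUP \<theta>\<in>v ` {z i..z (Suc i)}. h \<theta>) * (J v \<alpha> (v (z (Suc i))) - J v \<alpha> (v (z i)))"
        using P i J_diff_nonneg by (simp add: J_diff \<xi> mult_right_mono)
    qed
    then show ?thesis using telescope P by simp
  qed
  have fine: "\<exists>P\<in>subdivisions a b. ?I - e \<le> lower_sum v \<alpha> h P \<and> upper_sum v \<alpha> h P \<le> ?I + e"
    if "0 < e" for e
  proof -
    \<comment> \<open>Oscillation allowed on each piece, so that the total error is \<open>e\<close>.\<close>
    define e' where "e' = e / (\<rho> b - \<rho> a)"
    have e': "0 < e'" using \<open>0 < e\<close> \<rho>_ab by (simp add: e'_def)
    have "uniformly_continuous_on {a..b} (\<lambda>z. h (v z))"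
      using hv by (rule compact_uniformly_continuous) simp
    then obtain \<delta> where \<delta>: "0 < \<delta>"
      "\<And>x y. x \<in> {a..b} \<Longrightarrow> y \<in> {a..b} \<Longrightarrow> dist x y < \<delta> \<Longrightarrow> dist (h (v x)) (h (v y)) < e'"
      using e' unfolding uniformly_continuous_on_def by metis
    obtain N z where P: "(N, z) \<in> subdivisions a b" and mesh: "\<And>i. z (Suc i) - z i < \<delta>"
      using uniform_subdivision[OF ab \<delta>(1)] by blast
    have piece: "A (\<rho> (z (Suc i))) - A (\<rho> (z i)) - e' * (\<rho> (z (Suc i)) - \<rho> (z i)) \<le>
        (INF \<theta>\<in>v ` {z i..z (Suc i)}. h \<theta>) * (J v \<alpha> (v (z (Suc i))) - J v \<alpha> (v (z i))) \<and>
        (SUP \<theta>\<in>v ` {z i..z (Suc i)}. h \<theta>) * (J v \<alpha> (v (z (Suc i))) - J v \<alpha> (v (z i))) \<le>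
        A (\<rho> (z (Suc i))) - A (\<rho> (z i)) + e' * (\<rho> (z (Suc i)) - \<rho> (z i))" if i: "i < N" for i
    proof -
      obtain \<xi> where \<xi>: "\<xi> \<in> {z i..z (Suc i)}"
        "A (\<rho> (z (Suc i))) - A (\<rho> (z i)) = h (v \<xi>) * (\<rho> (z (Suc i)) - \<rho> (z i))"
        using mean_piece[of N z i] P i by auto
      have near: "\<bar>h (v x) - h (v \<xi>)\<bar> < e'" if "x \<in> {z i..z (Suc i)}" for x
      proof -
        have "dist x \<xi> < \<delta>" "x \<in> {a..b}" "\<xi> \<in> {a..b}"
          using that \<xi>(1) mesh[of i] range[OF P i] by (auto simp: dist_real_def)
        then show ?thesis using \<delta>(2)[of x \<xi>] by (simp add: dist_real_def)
      qed
      have "h (v \<xi>) - e' \<le> (INF \<theta>\<in>v ` {z i..z (Suc i)}. h \<theta>)"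
        using range[OF P i] by (intro cINF_greatest) (auto dest!: near)
      moreover have "(SUP \<theta>\<in>v ` {z i..z (Suc i)}. h \<theta>) \<le> h (v \<xi>) + e'"
        using range[OF P i] by (intro cSUP_least) (auto dest!: near)
      ultimately show ?thesis
        unfolding J_diff[OF P i] \<xi>(2) left_diff_distrib[symmetric] distrib_right[symmetric]
        using J_diff_nonneg[OF P i] by (simp add: mult_right_mono)
    qed
    have err: "(\<Sum>i<N. e' * (\<rho> (z (Suc i)) - \<rho> (z i))) = e"
      using P \<rho>_ab sum_lessThan_telescope[of "\<lambda>i. \<rho> (z i)" N]
      unfolding sum_distrib_left[symmetric] by (simp add: subdivisions_def e'_def)
    have "?I - e = (\<Sum>i<N. A (\<rho> (z (Suc i))) - A (\<rho> (z i)) - e' * (\<rho> (z (Suc i)) - \<rho> (z i)))"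
      unfolding sum_subtractf[where g = "\<lambda>i. e' * (\<rho> (z (Suc i)) - \<rho> (z i))"] err telescope[OF P] ..
    also have "\<dots> \<le> lower_sum v \<alpha> h (N, z)"
      unfolding lower_sum_def using piece by (auto intro!: sum_mono)
    finally have "?I - e \<le> lower_sum v \<alpha> h (N, z)" .
    moreover have "upper_sum v \<alpha> h (N, z) \<le>
        (\<Sum>i<N. A (\<rho> (z (Suc i))) - A (\<rho> (z i)) + e' * (\<rho> (z (Suc i)) - \<rho> (z i)))"
      unfolding upper_sum_def using piece by (auto intro!: sum_mono)
    moreover have "\<dots> = ?I + e"
      unfolding sum.distrib err telescope[OF P] ..
    ultimately show ?thesis using P by (intro bexI[of _ "(N, z)"]) auto
  qed
  note squeeze = SUP_eq_INF_squeeze[OF lower upper fine]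
  show "F_integrable v \<alpha> h a b"
    unfolding F_integrable_def using bounded squeeze by simp
  show "F_integral v \<alpha> h a b = integral {\<rho> a..\<rho> b} (\<lambda>t. h (w t))"
    unfolding F_integral_def using squeeze by (simp add: A_def)
qed

lemma F_integral_complex_eq_integral:
  fixes h :: "real ^ 'd \<Rightarrow> complex"
  assumes a: "0 < a" and ab: "a < b" and cont: "continuous_on {0<..} (\<lambda>t. h (w t))"
  shows "F_integrable_complex v \<alpha> h a b"
    and "F_integral_complex v \<alpha> h a b = integral {\<rho> a..\<rho> b} (\<lambda>t. h (w t))"
proof -
  note Re = F_integral_eq_integral[OF a ab continuous_on_Re[OF cont]]
  note Im = F_integral_eq_integral[OF a ab continuous_on_Im[OF cont]]
  show "F_integrable_complex v \<alpha> h a b"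
    using Re Im by (simp add: F_integrable_complex_def)
  have int: "(\<lambda>t. h (w t)) integrable_on {\<rho> a..\<rho> b}"
    using rise_pos[OF a] by (intro integrable_continuous_interval continuous_on_subset[OF cont]) auto
  show "F_integral_complex v \<alpha> h a b = integral {\<rho> a..\<rho> b} (\<lambda>t. h (w t))"
    using Re Im integral_unique[OF has_integral_Re[OF integrable_integral[OF int]]]
      integral_unique[OF has_integral_Im[OF integrable_integral[OF int]]]
    by (simp add: F_integral_complex_def complex_eq_iff)
qed

section \<open>The fractal Mellin transform as a Lebesgue integral\<close>

lemma unit_param_eq: "unit_param v \<alpha> = \<tau> 1"
  by (simp add: unit_param_def \<tau>_def)

lemma continuous_on_weighted_norm:
  fixes f :: "real ^ 'd \<Rightarrow> complex"
  assumes "continuous_on {0<..} (\<lambda>t. f (w t))"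
  shows "continuous_on {0<..} (\<lambda>t. norm (f (w t)) * J v \<alpha> (w t) powr l)"
proof -
  have "continuous_on {0<..} (\<lambda>t. norm (f (w t)) * t powr l)"
    using assms by (intro continuous_intros) auto
  then show ?thesis
    by (rule continuous_on_eq) (simp add: J_mass_param)
qed

lemma weighted_norm_cong:
  "0 < a \<Longrightarrow> integral {a..b} (\<lambda>t. norm (f (w t)) * J v \<alpha> (w t) powr l) =
    integral {a..b} (\<lambda>t. norm (f (w t) :: complex) * t powr l)"
  by (rule integral_cong) (simp add: J_mass_param)

lemma weighted_integral_mono:
  fixes H :: "real \<Rightarrow> complex"
  assumes cont: "continuous_on {0<..} H" and "0 < a" "{a..b} \<subseteq> {c..d}" "0 < c"
    and "\<And>t. t \<in> {a..b} \<Longrightarrow> t powr l \<le> t powr l'"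
  shows "integral {a..b} (\<lambda>t. norm (H t) * t powr l) \<le> integral {c..d} (\<lambda>t. norm (H t) * t powr l')"
proof -
  have int: "(\<lambda>t. norm (H t) * t powr m) integrable_on {x..y}" if "0 < x" for x y m
    using that by (intro integrable_continuous_interval continuous_intros continuous_on_subset[OF cont]) auto
  have "integral {a..b} (\<lambda>t. norm (H t) * t powr l) \<le> integral {a..b} (\<lambda>t. norm (H t) * t powr l')"
    using assms by (intro integral_le int mult_left_mono) auto
  also have "\<dots> \<le> integral {c..d} (\<lambda>t. norm (H t) * t powr l')"
    using assms by (intro integral_subset_le int) auto
  finally show ?thesis .
qed

text \<open>The integrand is nonnegative, so its integrals over \<open>[t, 1]\<close> grow as \<open>t\<close> decreases to \<open>0\<close>; a
  bound valid near \<open>0\<close>, which their convergence supplies, is therefore valid throughout.\<close>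

lemma F_integral_finite_at_0_bound:
  assumes cont: "continuous_on {0<..} (\<lambda>t. f (w t))"
    and fin: "F_integral_finite_at_0 v \<alpha> (\<lambda>\<theta>. norm (f \<theta> :: complex) * J v \<alpha> \<theta> powr l) (unit_param v \<alpha>)"
  obtains C where "\<And>t. 0 < t \<Longrightarrow> t < 1 \<Longrightarrow> integral {t..1} (\<lambda>t. norm (f (w t)) * t powr l) \<le> C"
proof -
  let ?F = "\<lambda>a. F_integral v \<alpha> (\<lambda>\<theta>. norm (f \<theta>) * J v \<alpha> \<theta> powr l) a (\<tau> 1)"
  have F_eq: "?F a = integral {\<rho> a..1} (\<lambda>t. norm (f (w t)) * t powr l)" if "0 < a" "a < \<tau> 1" for a
    using that F_integral_eq_integral(2)[OF that continuous_on_weighted_norm[OF cont]]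
    by (simp add: weighted_norm_cong rise_pos)
  obtain C where "(?F \<longlongrightarrow> C) (at_right 0)"
    using fin by (auto simp: F_integral_finite_at_0_def unit_param_eq)
  then have "\<forall>\<^sub>F a in at_right 0. ?F a < C + 1" by (rule order_tendstoD) simp
  then obtain d where d: "0 < d" "\<And>a. 0 < a \<Longrightarrow> a < d \<Longrightarrow> ?F a < C + 1"
    unfolding eventually_at_right_field by blast
  have "integral {t..1} (\<lambda>t. norm (f (w t)) * t powr l) \<le> C + 1" if t: "0 < t" "t < 1" for t
  proof -
    \<comment> \<open>A parameter below that of \<open>t\<close>, and so close to \<open>0\<close> that the bound holds there.\<close>
    define a where "a = min (\<tau> t) (d / 2)"
    have a: "0 < a" "a < d" "a \<le> \<tau> t" using t d rise_inv_pos[of t] by (auto simp: a_def)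
    then have "\<rho> a \<le> t" using rise_mono[of a "\<tau> t"] t by simp
    then have "integral {t..1} (\<lambda>t. norm (f (w t)) * t powr l) \<le>
        integral {\<rho> a..1} (\<lambda>t. norm (f (w t)) * t powr l)"
      using a t by (intro weighted_integral_mono cont) (auto simp: rise_pos)
    also have "\<dots> = ?F a"
      using a t rise_inv_strict_mono[of t 1] by (intro F_eq[symmetric]) auto
    finally show ?thesis using d(2)[OF a(1,2)] by simp
  qed
  then show ?thesis by (rule that)
qed

lemma F_integral_finite_at_infinity_bound:
  assumes cont: "continuous_on {0<..} (\<lambda>t. f (w t))"
    and fin: "F_integral_finite_at_infinity v \<alpha> (\<lambda>\<theta>. norm (f \<theta> :: complex) * J v \<alpha> \<theta> powr l) (unit_param v \<alpha>)"
  obtains C where "\<And>t. 1 < t \<Longrightarrow> integral {1..t} (\<lambda>t. norm (f (w t)) * t powr l) \<le> C"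
proof -
  let ?F = "\<lambda>b. F_integral v \<alpha> (\<lambda>\<theta>. norm (f \<theta>) * J v \<alpha> \<theta> powr l) (\<tau> 1) b"
  have F_eq: "?F b = integral {1..\<rho> b} (\<lambda>t. norm (f (w t)) * t powr l)" if "\<tau> 1 < b" for b
    using F_integral_eq_integral(2)[OF _ that continuous_on_weighted_norm[OF cont]]
    by (simp add: weighted_norm_cong rise_inv_pos)
  obtain C where "(?F \<longlongrightarrow> C) at_top"
    using fin by (auto simp: F_integral_finite_at_infinity_def unit_param_eq)
  then have "\<forall>\<^sub>F b in at_top. ?F b < C + 1" by (rule order_tendstoD) simp
  then obtain d where d: "\<And>b. d \<le> b \<Longrightarrow> ?F b < C + 1"
    by (auto simp: eventually_at_top_linorder)
  have "integral {1..t} (\<lambda>t. norm (f (w t)) * t powr l) \<le> C + 1" if t: "1 < t" for t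
  proof -
    define b where "b = max (\<tau> t) d"
    have b: "d \<le> b" "\<tau> t \<le> b" by (auto simp: b_def)
    then have "t \<le> \<rho> b" using rise_mono[of "\<tau> t" b] t by simp
    then have "integral {1..t} (\<lambda>t. norm (f (w t)) * t powr l) \<le>
        integral {1..\<rho> b} (\<lambda>t. norm (f (w t)) * t powr l)"
      using t by (intro weighted_integral_mono cont) auto
    also have "\<dots> = ?F b"
      using b t rise_inv_strict_mono[of 1 t] by (intro F_eq[symmetric]) auto
    finally show ?thesis using d[OF b(1)] by simp
  qed
  then show ?thesis by (rule that)
qed

text \<open>The exponent \<open>Re s\<close> lies between \<open>l1\<close> and \<open>l2\<close>, so the weight \<open>t powr (Re s - 1)\<close> is
  dominated by that of \<open>l1\<close> below \<open>1\<close> and by that of \<open>l2\<close> above \<open>1\<close>.\<close>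

lemma mellin_exists_imp_set_integrable:
  assumes cont: "continuous_on {0<..} (\<lambda>t. f (w t))" and ex: "mellin_exists v \<alpha> f s"
  shows "set_integrable lborel {0<..} (\<lambda>t. f (w t) * of_real t powr (s - 1))"
proof -
  obtain l1 l2 where l: "l1 < Re s" "Re s < l2"
    and fin: "F_integral_finite_at_0 v \<alpha> (\<lambda>\<theta>. norm (f \<theta>) * J v \<alpha> \<theta> powr (l1 - 1)) (unit_param v \<alpha>)"
      "F_integral_finite_at_infinity v \<alpha> (\<lambda>\<theta>. norm (f \<theta>) * J v \<alpha> \<theta> powr (l2 - 1)) (unit_param v \<alpha>)"
    using ex unfolding mellin_exists_def by blast
  obtain C0 where C0: "\<And>t. 0 < t \<Longrightarrow> t < 1 \<Longrightarrow> integral {t..1} (\<lambda>t. norm (f (w t)) * t powr (l1 - 1)) \<le> C0"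
    using F_integral_finite_at_0_bound[OF cont fin(1)] by blast
  obtain C1 where C1: "\<And>t. 1 < t \<Longrightarrow> integral {1..t} (\<lambda>t. norm (f (w t)) * t powr (l2 - 1)) \<le> C1"
    using F_integral_finite_at_infinity_bound[OF cont fin(2)] by blast
  let ?q = "\<lambda>t. norm (f (w t)) * t powr (Re s - 1)"
  have q_cont: "continuous_on {0<..} ?q" using cont by (intro continuous_intros) auto
  have q: "set_integrable lborel {0<..} ?q"
  proof (rule set_integrable_of_bounded_integrals[OF q_cont])
    fix a b :: real assume ab: "0 < a" "a < 1" "1 < b"
    have "?q integrable_on {a..b}"
      using ab by (intro integrable_continuous_interval continuous_on_subset[OF q_cont]) auto
    then have "integral {a..b} ?q = integral {a..1} ?q + integral {1..b} ?q"
      using ab by (simp add: Henstock_Kurzweil_Integration.integral_combine)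
    also have "integral {a..1} ?q \<le> integral {a..1} (\<lambda>t. norm (f (w t)) * t powr (l1 - 1))"
      using ab l by (intro weighted_integral_mono cont) (auto intro: powr_mono')
    also have "\<dots> \<le> C0" using ab by (intro C0)
    also have "integral {1..b} ?q \<le> integral {1..b} (\<lambda>t. norm (f (w t)) * t powr (l2 - 1))"
      using ab l by (intro weighted_integral_mono cont) (auto intro: powr_mono)
    also have "\<dots> \<le> C1" using ab by (intro C1)
    finally show "integral {a..b} ?q \<le> C0 + C1" by simp
  qed simp
  have "continuous_on {0<..} (\<lambda>t. f (w t) * of_real t powr (s - 1))"
    by (intro continuous_intros continuous_on_complex_powr_pos cont) auto
  then have "(\<lambda>t. indicator {0<..} t *\<^sub>R (f (w t) * of_real t powr (s - 1))) \<in> borel_measurable lborel"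
    using borel_measurable_continuous_on_indicator[of "{0::real<..}"] by simp
  then show ?thesis
    unfolding set_integrable_def
    by (rule Bochner_Integration.integrable_bound[OF q[unfolded set_integrable_def]])
      (auto intro!: AE_I2 simp: indicator_def norm_mult norm_powr_real_powr)
qed

text \<open>Splitting at \<open>J = 1\<close> separates the two ends, so that the joint limit reduces to a limit of
  Lebesgue integrals at each end.\<close>

lemma has_improper_F_integralI:
  fixes h :: "real ^ 'd \<Rightarrow> complex"
  assumes cont: "continuous_on {0<..} (\<lambda>t. h (w t))"
    and int: "set_integrable lborel {0<..} (\<lambda>t. h (w t))"
  shows "has_improper_F_integral v \<alpha> h (LBINT t:{0<..}. h (w t))"
  unfolding has_improper_F_integral_def
proof (intro conjI allI impI)
  let ?H = "\<lambda>t. h (w t)"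
  show "F_integrable_complex v \<alpha> h a b" if "0 < a \<and> a < b" for a b
    using that cont F_integral_complex_eq_integral(1) by blast
  have int': "set_integrable lborel {0<..1} ?H" "set_integrable lborel {1..} ?H"
    using int by (auto intro: set_integrable_subset)
  have \<rho>_0: "filterlim \<rho> (at_right 0) (at_right 0)"
    unfolding filterlim_at
  proof
    have "(\<rho> \<longlongrightarrow> \<rho> 0) (at 0 within {0..})"
      using continuous_on_rise unfolding continuous_on_def by (rule bspec) simp
    then show "(\<rho> \<longlongrightarrow> 0) (at_right 0)"
      by (auto intro: tendsto_within_subset)
    show "\<forall>\<^sub>F x in at_right 0. \<rho> x \<in> {0<..} \<and> \<rho> x \<noteq> 0"
      using eventually_at_right_less[of 0] by eventually_elim (use rise_pos in fastforce)
  qed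
  have \<rho>_top: "filterlim \<rho> at_top at_top"
    unfolding filterlim_at_top
  proof
    fix Z
    have "Z \<le> \<rho> z" if "\<tau> (max Z 0) \<le> z" for z
      using rise_mono[OF _ that] by simp
    then show "\<forall>\<^sub>F z in at_top. Z \<le> \<rho> z"
      by (rule eventually_at_top_linorderI)
  qed
  have "((\<lambda>a. LBINT t:{\<rho> a..1}. ?H t) \<longlongrightarrow> (LBINT t:{0<..1}. ?H t)) (at_right 0)"
    using int'(1) by (intro filterlim_compose[OF tendsto_set_lebesgue_integral_at_right \<rho>_0]) auto
  moreover have "((\<lambda>b. LBINT t:{1..\<rho> b}. ?H t) \<longlongrightarrow> (LBINT t:{1..}. ?H t)) at_top"
    using int'(2) by (intro filterlim_compose[OF tendsto_set_lebesgue_integral_at_top \<rho>_top]) auto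
  ultimately have lim: "((\<lambda>p. (LBINT t:{\<rho> (fst p)..1}. ?H t) + (LBINT t:{1..\<rho> (snd p)}. ?H t)) \<longlongrightarrow>
      (LBINT t:{0<..1}. ?H t) + (LBINT t:{1..}. ?H t)) (at_right 0 \<times>\<^sub>F at_top)"
    by (intro tendsto_add filterlim_compose[OF _ filterlim_fst] filterlim_compose[OF _ filterlim_snd])
  have "(LBINT t:{0<..1} \<union> {1..}. ?H t) = (LBINT t:{0<..1}. ?H t) + (LBINT t:{1..}. ?H t)"
    using AE_lborel_singleton[of 1] int' by (intro set_integral_Un_AE) (auto elim!: eventually_mono)
  moreover have "{0<..1} \<union> {1..} = {0::real<..}" by auto
  ultimately have total: "(LBINT t:{0<..1}. ?H t) + (LBINT t:{1..}. ?H t) = (LBINT t:{0<..}. ?H t)"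
    by simp
  have "0 < \<tau> 1" by (rule rise_inv_pos) simp
  have piece: "F_integral_complex v \<alpha> h a b = (LBINT t:{\<rho> a..1}. ?H t) + (LBINT t:{1..\<rho> b}. ?H t)"
    if a: "0 < a" "a < \<tau> 1" and b: "\<tau> 1 < b" for a b
  proof -
    have \<rho>: "0 < \<rho> a" "\<rho> a < 1" "1 < \<rho> b"
      using rise_pos[OF a(1)] rise_strict_mono[of a "\<tau> 1"] rise_strict_mono[of "\<tau> 1" b] a b by simp_all
    have cont': "continuous_on {x..y} ?H" if "0 < x" for x y
      using that by (intro continuous_on_subset[OF cont]) auto
    have "F_integral_complex v \<alpha> h a b = integral {\<rho> a..\<rho> b} ?H"
      using a b cont by (intro F_integral_complex_eq_integral) auto
    also have "\<dots> = integral {\<rho> a..1} ?H + integral {1..\<rho> b} ?H"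
      using \<rho> cont'[OF \<rho>(1)]
      by (intro Henstock_Kurzweil_Integration.integral_combine[symmetric] integrable_continuous_interval) auto
    also have "\<dots> = (LBINT t:{\<rho> a..1}. ?H t) + (LBINT t:{1..\<rho> b}. ?H t)"
      using \<rho> cont' by (simp add: set_borel_integral_eq_integral borel_integrable_atLeastAtMost')
    finally show ?thesis .
  qed
  have "\<forall>\<^sub>F p in at_right 0 \<times>\<^sub>F at_top.
      (LBINT t:{\<rho> (fst p)..1}. ?H t) + (LBINT t:{1..\<rho> (snd p)}. ?H t) =
      (case p of (a, b) \<Rightarrow> F_integral_complex v \<alpha> h a b)"
  proof -
    have "\<forall>\<^sub>F p in at_right 0 \<times>\<^sub>F at_top. (0 < fst p \<and> fst p < \<tau> 1) \<and> \<tau> 1 < snd p"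
      using \<open>0 < \<tau> 1\<close> eventually_at_right_real[of 0 "\<tau> 1"] eventually_gt_at_top[of "\<tau> 1"]
      by (intro eventually_prodI) (auto elim: eventually_mono)
    then show ?thesis
      by eventually_elim (auto simp: piece)
  qed
  with lim show "((\<lambda>(a, b). F_integral_complex v \<alpha> h a b) \<longlongrightarrow> (LBINT t:{0<..}. ?H t))
      (at_right 0 \<times>\<^sub>F at_top)"
    unfolding total by (rule Lim_transform_eventually)
qed

lemma has_improper_F_integral_unique:
  assumes "has_improper_F_integral v \<alpha> h I" "has_improper_F_integral v \<alpha> h I'"
  shows "I = I'"
proof -
  have "at_right (0::real) \<times>\<^sub>F (at_top :: real filter) \<noteq> bot"
    by (simp add: prod_filter_eq_bot)
  then show ?thesis
    using assms unfolding has_improper_F_integral_def by (blast intro: tendsto_unique)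
qed

text \<open>The improper integral defining the transform exists because the Lebesgue integral converges
  absolutely, and limits are unique; hence the definite description in \<open>mellin\<close> denotes that
  Lebesgue integral.\<close>

lemma mellin_eq_Lebesgue_integral:
  assumes cont: "continuous_on {0<..} (\<lambda>t. f (w t))" and ex: "mellin_exists v \<alpha> f s"
  shows "mellin v \<alpha> f s = (LBINT t:{0<..}. f (w t) * of_real t powr (s - 1))"
proof -
  let ?h = "\<lambda>\<theta>. f \<theta> * of_real (J v \<alpha> \<theta>) powr (s - 1)"
  let ?H = "\<lambda>t. f (w t) * of_real t powr (s - 1)"
  have eq: "?h (w t) = ?H t" if "t \<in> {0<..}" for t
    using that by (simp add: J_mass_param)
  have "continuous_on {0<..} ?H"
    by (intro continuous_intros continuous_on_complex_powr_pos cont) auto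
  then have "continuous_on {0<..} (\<lambda>t. ?h (w t))"
    by (rule continuous_on_eq) (simp add: eq)
  moreover have "set_integrable lborel {0<..} (\<lambda>t. ?h (w t))"
    using mellin_exists_imp_set_integrable[OF assms]
    by (subst set_integrable_cong[OF refl refl eq]) auto
  ultimately have "has_improper_F_integral v \<alpha> ?h (LBINT t:{0<..}. ?h (w t))"
    by (rule has_improper_F_integralI)
  then have "mellin v \<alpha> f s = (LBINT t:{0<..}. ?h (w t))"
    unfolding mellin_def using has_improper_F_integral_unique by blast
  also have "\<dots> = (LBINT t:{0<..}. ?H t)"
    using eq by (intro set_lebesgue_integral_cong) auto
  finally show ?thesis .
qed

end

section \<open>The Mellin transform of the iterated derivative\<close>

theorem theorem2:
  fixes v :: "real \<Rightarrow> real ^ 'd" and \<alpha> :: real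
    and f :: "real ^ 'd \<Rightarrow> complex" and n :: nat and s :: complex
  assumes "fractal_curve v \<alpha>"
    and "n \<ge> 1"
    and "f \<in> C_n v \<alpha> n"
    and "mellin_exists v \<alpha> ((F_deriv v \<alpha> ^^ n) f) s"
    and "mellin_exists v \<alpha> f (s - of_nat n)"
  shows "mellin v \<alpha> ((F_deriv v \<alpha> ^^ n) f) s = Gamma_quotient n s * mellin v \<alpha> f (s - of_nat n)"
proof -
  interpret fractal_curve_by_mass v \<alpha> by unfold_locales (rule assms(1))
  define G where "G k t = (F_deriv v \<alpha> ^^ k) f (w t)" for k t
  have deriv: "(G k has_vector_derivative G (Suc k) t) (at t)" if "k < n" "0 < t" for k t
    using C_n_has_vector_derivative[OF assms(3) that] by (simp add: G_def[abs_def])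
  have cont_n: "continuous_on {0<..} (G n)"
    using assms(3) unfolding G_def C_n_def by (intro continuous_on_mass_param_comp) simp
  have cont_0: "continuous_on {0<..} (\<lambda>t. f (w t))"
  proof (rule continuous_at_imp_continuous_on, rule ballI)
    fix t :: real assume "t \<in> {0<..}"
    then have "isCont (G 0) t"
      using has_vector_derivative_continuous[OF deriv[of 0 t]] assms(2) by simp
    then show "isCont (\<lambda>t. f (w t)) t" by (simp add: G_def[abs_def])
  qed
  show ?thesis
    using mellin_integral_iterated_derivative[of n G s, OF deriv cont_n]
      mellin_exists_imp_set_integrable[OF cont_n[unfolded G_def] assms(4)]
      mellin_exists_imp_set_integrable[OF cont_0 assms(5)]
    by (simp add: mellin_eq_Lebesgue_integral[OF cont_n[unfolded G_def] assms(4)]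
      mellin_eq_Lebesgue_integral[OF cont_0 assms(5)] Gamma_quotient_eq_prod G_def)
qed

end
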